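(* Let $G$ be a finite simple connected outerplanar graph with at least two vertices. Then $G$ has a complete conflict-free coloring with $4$ colors, i.e. a map $C:V(G)\to\{1,2,3,4\}$ such that for every $v\in V(G)$ there exists $i\in\{1,2,3,4\}$ with $|N(v)\cap C^{-1}(i)|=1$. Equivalently, $\chi_{CF}(G)\le 4$.
   Context: $N(v)$ denotes the open neighborhood of $v$. An outerplanar graph is one having a planar drawing with all vertices on the outer face. $\chi_{CF}(G)$ is the smallest number of colors in a complete conflict-free coloring (every vertex receives a color and every vertex has some color appearing exactly once in its open neighborhood). *)

theory Defs
  imports "Graph_Theory.Digraph_Component" "HOL-Analysis.Analysis"
begin

text \<open>
  A finite simple graph is a \<^locale>\<open>graph\<close> of \<^theory>\<open>Graph_Theory.Digraph\<close>: a finite symmetric digraph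
  without loops and parallel arcs. An undirected edge is then a pair of opposite arcs; in a
  drawing it must be a single curve, so drawings are indexed by the two-element sets below.
\<close>

definition edges :: "('a, 'b) pre_digraph \<Rightarrow> 'a set set" where
  "edges G = {{u, v} | u v. u \<rightarrow>\<^bsub>G\<^esub> v}"

definition nbhd :: "('a, 'b) pre_digraph \<Rightarrow> 'a \<Rightarrow> 'a set" where
  "nbhd G v = {u. v \<rightarrow>\<^bsub>G\<^esub> u}"

text \<open>
  In the plane \<^typ>\<open>complex\<close>, the vertex \<open>v\<close> is drawn as the point \<open>p v\<close> and the edge \<open>e\<close> as the
  simple arc \<open>\<gamma> e\<close> (in either direction). An arc meets the vertex points only in its two ends,
  and distinct arcs meet only in the points of common end vertices.
\<close>

definition planar_drawing ::
  "('a, 'b) pre_digraph \<Rightarrow> ('a \<Rightarrow> complex) \<Rightarrow> ('a set \<Rightarrow> real \<Rightarrow> complex) \<Rightarrow> bool" where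
  "planar_drawing G p \<gamma> \<longleftrightarrow>
     inj_on p (verts G) \<and>
     (\<forall>e\<in>edges G. arc (\<gamma> e) \<and> {pathstart (\<gamma> e), pathfinish (\<gamma> e)} = p ` e
        \<and> path_image (\<gamma> e) \<inter> p ` verts G = p ` e) \<and>
     (\<forall>e\<in>edges G. \<forall>f\<in>edges G. e \<noteq> f \<longrightarrow>
        path_image (\<gamma> e) \<inter> path_image (\<gamma> f) \<subseteq> p ` (e \<inter> f))"

definition drawing_points ::
  "('a, 'b) pre_digraph \<Rightarrow> ('a \<Rightarrow> complex) \<Rightarrow> ('a set \<Rightarrow> real \<Rightarrow> complex) \<Rightarrow> complex set" where
  "drawing_points G p \<gamma> = p ` verts G \<union> (\<Union>e\<in>edges G. path_image (\<gamma> e))"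

text \<open>
  The point set of a drawing of a finite graph is compact, so its complement has exactly one
  unbounded component, which is its \<^const>\<open>outside\<close>. A vertex lies on this face if it is a
  point of the boundary.
\<close>

definition outer_face ::
  "('a, 'b) pre_digraph \<Rightarrow> ('a \<Rightarrow> complex) \<Rightarrow> ('a set \<Rightarrow> real \<Rightarrow> complex) \<Rightarrow> complex set" where
  "outer_face G p \<gamma> = outside (drawing_points G p \<gamma>)"

definition outerplanar :: "('a, 'b) pre_digraph \<Rightarrow> bool" where
  "outerplanar G \<longleftrightarrow>
     (\<exists>p \<gamma>. planar_drawing G p \<gamma> \<and> (\<forall>v\<in>verts G. p v \<in> frontier (outer_face G p \<gamma>)))"

definition complete_cf_coloring :: "('a, 'b) pre_digraph \<Rightarrow> nat \<Rightarrow> ('a \<Rightarrow> nat) \<Rightarrow> bool" where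
  "complete_cf_coloring G k C \<longleftrightarrow>
     C \<in> verts G \<rightarrow> {1..k} \<and>
     (\<forall>v\<in>verts G. \<exists>i\<in>{1..k}. card (nbhd G v \<inter> C -` {i}) = 1)"

text \<open>
  Meaningful only if some complete conflict-free coloring exists: a graph with an isolated vertex
  has none.
\<close>

definition chi_CF :: "('a, 'b) pre_digraph \<Rightarrow> nat" where
  "chi_CF G = (LEAST k. \<exists>C. complete_cf_coloring G k C)"

end

theory Submission
  imports Defs "HOL-Complex_Analysis.Winding_Numbers"
begin

text \<open>
  The only consequence of outerplanarity that is needed is the absence of a \<open>K\<^bsub>2,3\<^esub>\<close> minor. Such a
  minor gives three arcs with common ends, each carrying a further vertex, and one of the three
  arcs of a theta curve runs inside the closed curve formed by the other two, so its vertex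
  is not on the outer face.

  For the colouring choose a maximal set \<open>X\<close> of vertices with disjoint closed neighbourhoods that was
  grown in steps of distance 3, so that \<open>N[X]\<close> is connected and dominates every remaining vertex.
  Colour 4 is used exactly on \<open>X\<close> and serves \<open>N(X)\<close>. The set \<open>N(X)\<close> is coloured with 1, 2, 3, one star
  at a time, such that each vertex \<open>w\<close> of \<open>X\<close> or of the rest \<open>Z\<close> has a neighbour \<open>f w\<close> of unique colour in
  \<open>N(X)\<close>. Since \<open>N[X]\<close> is connected, a vertex of \<open>Z\<close> has at most two neighbours in \<open>Z\<close>; it takes one of the
  colours 1, 2, 3 that is not the colour of \<open>f z\<close> for any of these neighbours \<open>z\<close>.
\<close>

section \<open>Two-colouring\<close>

abbreviation reach_in :: "('a \<Rightarrow> 'a \<Rightarrow> bool) \<Rightarrow> 'a set \<Rightarrow> 'a \<Rightarrow> 'a \<Rightarrow> bool" where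
  "reach_in P S \<equiv> (\<lambda>u v. u \<in> S \<and> v \<in> S \<and> P u v)\<^sup>*\<^sup>*"

lemma reach_in_mono: "reach_in P S u v \<Longrightarrow> S \<subseteq> T \<Longrightarrow> reach_in P T u v"
  by (erule rtranclp_mono[THEN predicate2D, rotated]) auto

text \<open>The last hypothesis excludes cycles: a cycle through \<open>u\<close> would link two
  neighbours of \<open>u\<close> inside \<open>S - {u}\<close>. It passes to subsets, so this forest
  can be coloured by adding one vertex \<open>y\<close> at a time.\<close>

lemma two_coloring:
  assumes "finite S" and sym: "\<And>u v. P u v \<Longrightarrow> P v u" and irrefl: "\<And>u. \<not> P u u"
    and "\<And>u v w. u \<in> S \<Longrightarrow> v \<in> S \<Longrightarrow> w \<in> S \<Longrightarrow> P u v \<Longrightarrow> P u w \<Longrightarrow> v \<noteq> w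
      \<Longrightarrow> \<not> reach_in P (S - {u}) v w"
  shows "\<exists>d :: 'a \<Rightarrow> bool. \<forall>u\<in>S. \<forall>v\<in>S. P u v \<longrightarrow> d u \<noteq> d v"
  using assms(1,4)
proof (induction S rule: finite_induct)
  case empty
  then show ?case by simp
next
  case (insert y S)
  \<comment> \<open>Each component of \<open>S\<close> contains at most one neighbour of \<open>y\<close>, so flipping the colours of
    components gives all neighbours of \<open>y\<close> the same colour.\<close>
  have "\<exists>d :: 'a \<Rightarrow> bool. \<forall>u\<in>S. \<forall>v\<in>S. P u v \<longrightarrow> d u \<noteq> d v"
  proof (rule insert.IH)
    fix u v w assume *: "u \<in> S" "v \<in> S" "w \<in> S" "P u v" "P u w" "v \<noteq> w"
    then have "\<not> reach_in P (insert y S - {u}) v w" by (intro insert.prems) auto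
    then show "\<not> reach_in P (S - {u}) v w"
      using reach_in_mono[where S = "S - {u}" and T = "insert y S - {u}" and P = P] by blast
  qed
  then obtain d :: "'a \<Rightarrow> bool" where d: "\<And>u v. u \<in> S \<Longrightarrow> v \<in> S \<Longrightarrow> P u v \<Longrightarrow> d u \<noteq> d v"
    by auto
  let ?R = "reach_in P S"
  have Rsym: "?R u v \<Longrightarrow> ?R v u" for u v
    by (rule symp_rtranclp[THEN sympD]) (auto intro!: sympI dest: sym)
  have uniq: "n = n'" if "n \<in> S" "n' \<in> S" "P y n" "P y n'" "?R n u" "?R n' u" for n n' u
  proof (rule ccontr)
    assume "n \<noteq> n'"
    moreover have "?R n n'"
      using that Rsym rtranclp_trans by fast
    moreover have "insert y S - {y} = S"
      using insert.hyps by simp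
    ultimately show False
      using insert.prems[of y n n'] that by simp
  qed
  define d' where "d' u = (if u = y then False
      else if \<exists>n\<in>S. P y n \<and> ?R n u then \<exists>n\<in>S. P y n \<and> ?R n u \<and> d u = d n else d u)" for u
  have eq: "d' u = (d u = d n)" if "n \<in> S" "P y n" "?R n u" "u \<in> S" for u n
  proof -
    have "u \<noteq> y" using that insert.hyps by auto
    moreover have "(\<exists>m\<in>S. P y m \<and> ?R m u \<and> d u = d m) \<longleftrightarrow> d u = d n"
      using that uniq[of _ n u] by blast
    ultimately show ?thesis
      using that unfolding d'_def by auto
  qed
  have eq': "d' u = d u" if "\<not> (\<exists>n\<in>S. P y n \<and> ?R n u)" "u \<in> S" for u
  proof -
    have "u \<noteq> y" using that insert.hyps by auto
    then show ?thesis using that unfolding d'_def by auto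
  qed
  have dy: "d' y = False" by (simp add: d'_def)
  have nbs: "d' u" if "u \<in> S" "P y u" for u
    using eq[of u u] that by simp
  have "d' u \<noteq> d' v" if "u \<in> S" "v \<in> S" "P u v" for u v
  proof (cases "\<exists>n\<in>S. P y n \<and> ?R n u")
    case True
    then obtain n where n: "n \<in> S" "P y n" "?R n u" by blast
    have "?R n v" using n(3) that by (auto intro: rtranclp.rtrancl_into_rtrancl)
    then show ?thesis using eq[OF n that(1)] eq[OF n(1,2) _ that(2)] d[OF that] by blast
  next
    case False
    have "\<not> (\<exists>n\<in>S. P y n \<and> ?R n v)"
    proof
      assume "\<exists>n\<in>S. P y n \<and> ?R n v"
      then obtain n where n: "n \<in> S" "P y n" "?R n v" by blast
      have "?R n u" using n(3) that sym by (auto intro: rtranclp.rtrancl_into_rtrancl)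
      then show False using False n by blast
    qed
    then show ?thesis using eq'[OF False that(1)] eq'[OF _ that(2)] d[OF that] by blast
  qed
  then have "\<forall>u\<in>insert y S. \<forall>v\<in>insert y S. P u v \<longrightarrow> d' u \<noteq> d' v"
    using dy nbs sym irrefl by blast
  then show ?case by blast
qed

section \<open>Connected sets and minors of type K(2,3)\<close>

locale sym_rel =
  fixes adj :: "'a \<Rightarrow> 'a \<Rightarrow> bool"
  assumes adj_sym: "adj u v \<Longrightarrow> adj v u"
begin

text \<open>Stated through cuts instead of walks: later proofs build connected sets by unions and
  need a crossing edge directly.\<close>

definition conn :: "'a set \<Rightarrow> bool" where
  "conn S \<longleftrightarrow> S \<noteq> {} \<and> (\<forall>T\<subseteq>S. T \<noteq> {} \<longrightarrow> T \<noteq> S \<longrightarrow> (\<exists>u\<in>T. \<exists>v\<in>S - T. adj u v))"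

definition touch :: "'a set \<Rightarrow> 'a set \<Rightarrow> bool" where
  "touch A S \<longleftrightarrow> (\<exists>a\<in>A. \<exists>s\<in>S. adj a s)"

lemma touchI: "a \<in> A \<Longrightarrow> s \<in> S \<Longrightarrow> adj a s \<Longrightarrow> touch A S"
  by (auto simp: touch_def)

lemma touch_commute: "touch A S \<Longrightarrow> touch S A"
  by (auto simp: touch_def dest: adj_sym)

lemma touch_mono: "touch A S \<Longrightarrow> A \<subseteq> A' \<Longrightarrow> S \<subseteq> S' \<Longrightarrow> touch A' S'"
  unfolding touch_def by blast

lemma conn_ne: "conn S \<Longrightarrow> S \<noteq> {}"
  by (simp add: conn_def)

lemma conn_edge:
  "conn S \<Longrightarrow> T \<subseteq> S \<Longrightarrow> T \<noteq> {} \<Longrightarrow> T \<noteq> S \<Longrightarrow> \<exists>u\<in>T. \<exists>v\<in>S - T. adj u v"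
  by (simp add: conn_def)

lemma conn_singleton: "conn {v}"
  by (auto simp: conn_def)

lemma conn_Un:
  assumes "conn S" "conn T" and meet: "S \<inter> T \<noteq> {} \<or> touch S T"
  shows "conn (S \<union> T)"
  unfolding conn_def
proof (intro conjI allI impI)
  show "S \<union> T \<noteq> {}" using conn_ne[OF assms(1)] by simp
  fix U assume U: "U \<subseteq> S \<union> T" "U \<noteq> {}" "U \<noteq> S \<union> T"
  \<comment> \<open>If \<open>U\<close> splits neither \<open>S\<close> nor \<open>T\<close>, it
    equals one of them and misses the other; then \<open>meet\<close> supplies the edge.\<close>
  consider "U \<inter> S \<noteq> {}" "\<not> S \<subseteq> U" | "U \<inter> T \<noteq> {}" "\<not> T \<subseteq> U"
    | "S \<subseteq> U" "U \<inter> T = {}" | "T \<subseteq> U" "U \<inter> S = {}"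
    using U by blast
  then show "\<exists>u\<in>U. \<exists>v\<in>S \<union> T - U. adj u v"
  proof cases
    case 1
    then show ?thesis using conn_edge[OF assms(1), of "U \<inter> S"] by blast
  next
    case 2
    then show ?thesis using conn_edge[OF assms(2), of "U \<inter> T"] by blast
  next
    case 3
    then show ?thesis using meet unfolding touch_def by blast
  next
    case 4
    then show ?thesis using meet adj_sym unfolding touch_def by blast
  qed
qed

lemma conn_insert: "conn S \<Longrightarrow> touch S {v} \<Longrightarrow> conn (insert v S)"
  using conn_Un[of S "{v}"] conn_singleton by simp

lemma conn_Un_family:
  assumes "conn S" and "finite T" and "\<And>t. t \<in> T \<Longrightarrow> touch S {t}"
  shows "conn (S \<union> T)"
  using assms(2,3)
proof (induction T rule: finite_induct)
  case (insert t T)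
  then have "conn (insert t (S \<union> T))"
    by (intro conn_insert) (auto simp: touch_def)
  then show ?case by simp
qed (use assms(1) in simp)

text \<open>A maximal proper connected subset together with the far end of an edge leaving it is
  connected, hence all of \<open>S\<close>; that end is the removable vertex.\<close>

lemma conn_non_cut:
  assumes "conn S" "finite S" "\<And>v. S \<noteq> {v}"
  shows "\<exists>w\<in>S. conn (S - {w}) \<and> touch (S - {w}) {w}"
proof -
  let ?P = "\<lambda>T. T \<subset> S \<and> conn T"
  obtain s where s: "s \<in> S" using conn_ne[OF assms(1)] by blast
  have fin: "finite {T. ?P T}" using assms(2) by (auto intro: finite_subset[of _ "Pow S"])
  show ?thesis
  proof (cases "\<exists>T. ?P T")
    case True
    then obtain T where T: "?P T" and max: "\<And>U. ?P U \<Longrightarrow> T \<subseteq> U \<Longrightarrow> T = U"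
      using finite_has_maximal[OF fin] by auto
    obtain u w where uw: "u \<in> T" "w \<in> S - T" "adj u w"
      using conn_edge[OF assms(1), of T] T conn_ne by blast
    have t: "touch T {w}" using uw by (auto simp: touch_def)
    have "insert w T = S"
      using max[of "insert w T"] conn_insert[OF _ t] T uw by blast
    then have "S - {w} = T" using uw by blast
    then show ?thesis using T t uw by auto
  next
    case False
    moreover have "{s} \<subset> S" using assms(3) s by blast
    ultimately show ?thesis using conn_singleton[of s] by blast
  qed
qed

text \<open>
  In a tripod the centre \<open>a\<close> is joined to \<open>x\<close>, \<open>y\<close>, \<open>z\<close> by disjoint legs; a leg is empty if its end
  is \<open>a\<close> itself. This reduces a contracted vertex of degree 3 to a single vertex.
\<close>

definition hooked :: "'a \<Rightarrow> 'a set \<Rightarrow> 'a \<Rightarrow> bool" where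
  "hooked a S x \<longleftrightarrow> (S = {} \<and> x = a) \<or> (conn S \<and> x \<in> S \<and> a \<notin> S \<and> touch {a} S)"

definition tripod :: "'a set \<Rightarrow> 'a \<Rightarrow> 'a \<Rightarrow> 'a \<Rightarrow> 'a \<Rightarrow> 'a set \<Rightarrow> 'a set \<Rightarrow> 'a set \<Rightarrow> bool" where
  "tripod A x y z a S T U \<longleftrightarrow> a \<in> A \<and> S \<subseteq> A \<and> T \<subseteq> A \<and> U \<subseteq> A
     \<and> hooked a S x \<and> hooked a T y \<and> hooked a U z \<and> S \<inter> T = {} \<and> S \<inter> U = {} \<and> T \<inter> U = {}"

lemma tripod_rotate: "tripod A x y z a S T U \<Longrightarrow> tripod A y z x a T U S"
  by (auto simp: tripod_def)

lemma tripod_mono: "tripod A x y z a S T U \<Longrightarrow> A \<subseteq> B \<Longrightarrow> tripod B x y z a S T U"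
  unfolding tripod_def by blast

section \<open>Tripods inside a connected set\<close>

lemma hooked_extend:
  assumes "hooked a S n" "adj n w" "w \<noteq> a"
  shows "hooked a (insert w S) w"
proof (cases "S = {}")
  case True
  then show ?thesis using assms by (auto simp: hooked_def touch_def conn_singleton)
next
  case False
  then have S: "conn S" "n \<in> S" "a \<notin> S" "touch {a} S" using assms by (auto simp: hooked_def)
  have "touch S {w}" using S assms by (auto simp: touch_def)
  from conn_insert[OF S(1) this] S assms show ?thesis by (auto simp: hooked_def touch_def)
qed

lemma tripod_extend:
  assumes "tripod (A - {w}) n y z a S T U" "adj n w" "w \<in> A"
  shows "tripod A w y z a (insert w S) T U"
  using assms hooked_extend[of a S n w] by (auto simp: tripod_def)

text \<open>When two ends coincide with \<open>w\<close>, it can be the centre; at most one leg is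
  then nonempty, and all of \<open>A - {w}\<close> can be taken for it.\<close>

lemma tripod_hub:
  assumes "conn (A - {w})" "touch (A - {w}) {w}" "w \<in> A" "z \<in> A"
  shows "\<exists>U. tripod A w w z w {} {} U"
proof (cases "z = w")
  case True
  then show ?thesis using assms by (intro exI[of _ "{}"]) (auto simp: tripod_def hooked_def)
next
  case False
  then show ?thesis using assms touch_commute
    by (intro exI[of _ "A - {w}"]) (auto simp: tripod_def hooked_def)
qed

text \<open>Induction that removes a non-cut vertex \<open>w\<close>. If exactly one end is
  \<open>w\<close>, a leg ending at its neighbour \<open>n\<close> is prolonged to \<open>w\<close>;
  if at least two ends are \<open>w\<close>, \<open>tripod_hub\<close> applies. Rotation reduces the
  other positions to these.\<close>

lemma tripod_exists:
  assumes "conn A" "finite A" "x \<in> A" "y \<in> A" "z \<in> A"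
  shows "\<exists>a S T U. tripod A x y z a S T U"
  using assms(2,1,3-)
proof (induction A arbitrary: x y z rule: finite_psubset_induct)
  case (psubset A)
  show ?case
  proof (cases "\<exists>v. A = {v}")
    case True
    then show ?thesis using psubset.prems
      by (intro exI[of _ x] exI[of _ "{}"]) (auto simp: tripod_def hooked_def)
  next
    case False
    then obtain w where w: "w \<in> A" "conn (A - {w})" "touch (A - {w}) {w}"
      using conn_non_cut[OF psubset.prems(1) psubset.hyps(1)] by blast
    obtain n where n: "n \<in> A - {w}" "adj n w" using w(3) by (auto simp: touch_def)
    have IH: "\<exists>a S T U. tripod (A - {w}) x y z a S T U"
      if "x \<in> A - {w}" "y \<in> A - {w}" "z \<in> A - {w}" for x y z
      using psubset.IH[of "A - {w}" x y z] w that by blast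
    have one: "\<exists>a S T U. tripod A w y z a S T U" if "y \<in> A - {w}" "z \<in> A - {w}" for y z
      using IH[OF n(1) that] tripod_extend[OF _ n(2) w(1)] by blast
    have two: "\<exists>a S T U. tripod A w w z a S T U" if "z \<in> A" for z
      using tripod_hub[OF w(2,3,1) that] by blast
    have none: "\<exists>a S T U. tripod A x y z a S T U"
      if "x \<in> A - {w}" "y \<in> A - {w}" "z \<in> A - {w}" for x y z
      using IH[OF that] tripod_mono[of "A - {w}" x y z _ _ _ _ A] by blast
    have rot: "\<exists>a S T U. tripod A y z x a S T U" if "\<exists>a S T U. tripod A x y z a S T U" for x y z
      using that tripod_rotate[of A x y z] by blast
    consider "x \<noteq> w" "y \<noteq> w" "z \<noteq> w" | "x = w" "y \<noteq> w" "z \<noteq> w" | "x \<noteq> w" "y = w" "z \<noteq> w"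
      | "x \<noteq> w" "y \<noteq> w" "z = w" | "x = w" "y = w" | "y = w" "z = w" | "z = w" "x = w"
      by blast
    then show ?thesis
    proof cases
      case 1 then show ?thesis using none psubset.prems by simp
    next
      case 2 then show ?thesis using one psubset.prems by simp
    next
      case 3 then show ?thesis using rot[OF rot[OF one[of z x]]] psubset.prems by simp
    next
      case 4 then show ?thesis using rot[OF one[of x y]] psubset.prems by simp
    next
      case 5 then show ?thesis using two psubset.prems by simp
    next
      case 6 then show ?thesis using rot[OF rot[OF two[of x]]] psubset.prems by simp
    next
      case 7 then show ?thesis using rot[OF two[of y]] psubset.prems by simp
    qed
  qed
qed

section \<open>Minors of type K(2,3) and contraction of their two hubs\<close>

definition K23_minor :: "'a set \<Rightarrow> 'a set \<Rightarrow> 'a set \<Rightarrow> 'a set \<Rightarrow> 'a set \<Rightarrow> bool" where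
  "K23_minor A B S T U \<longleftrightarrow>
     conn A \<and> conn B \<and> conn S \<and> conn T \<and> conn U \<and> A \<inter> B = {} \<and>
     (A \<union> B) \<inter> (S \<union> T \<union> U) = {} \<and> S \<inter> T = {} \<and> S \<inter> U = {} \<and> T \<inter> U = {} \<and>
     touch A S \<and> touch A T \<and> touch A U \<and> touch B S \<and> touch B T \<and> touch B U"

lemma conn_Un_hooked:
  assumes "hooked a S x" "conn T" "t \<in> T" "adj x t"
  shows "conn (S \<union> T) \<and> touch {a} (S \<union> T)"
proof (cases "S = {}")
  case True
  then show ?thesis using assms by (auto simp: hooked_def touch_def)
next
  case False
  then have S: "conn S" "x \<in> S" "touch {a} S" using assms(1) by (auto simp: hooked_def)
  then have "touch S T" using assms by (auto simp: touch_def)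
  then show ?thesis using conn_Un[OF S(1) assms(2)] S by (auto simp: touch_def)
qed

text \<open>The centre of a tripod in \<open>A\<close> towards the three attachments replaces
  \<open>A\<close>, and each leg is absorbed by the branch set it leads to. Contacts with
  \<open>B\<close> persist because these branch sets only grow.\<close>

lemma K23_minor_contract_side:
  assumes "K23_minor A B S T U" "finite A"
  shows "\<exists>a\<in>A. \<exists>S' T' U'. K23_minor {a} B S' T' U' \<and> S' \<union> T' \<union> U' \<subseteq> A \<union> S \<union> T \<union> U"
proof -
  obtain x y z s t u where e: "x \<in> A" "y \<in> A" "z \<in> A" "s \<in> S" "t \<in> T" "u \<in> U"
    "adj x s" "adj y t" "adj z u"
    using assms(1) by (fastforce simp: K23_minor_def touch_def)
  have A: "conn A" and c: "conn S" "conn T" "conn U" using assms(1) by (simp_all add: K23_minor_def)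
  obtain a P Q R where tr: "tripod A x y z a P Q R"
    using tripod_exists[OF A assms(2) e(1-3)] by blast
  then have h: "hooked a P x" "hooked a Q y" "hooked a R z" by (auto simp: tripod_def)
  have K: "touch B S" "touch B T" "touch B U" "A \<inter> B = {}"
    "(A \<union> B) \<inter> (S \<union> T \<union> U) = {}" "S \<inter> T = {}" "S \<inter> U = {}" "T \<inter> U = {}" "conn B"
    using assms by (simp_all add: K23_minor_def)
  have tr': "a \<in> A" "P \<subseteq> A" "Q \<subseteq> A" "R \<subseteq> A" "P \<inter> Q = {}" "P \<inter> R = {}" "Q \<inter> R = {}"
    using tr by (simp_all add: tripod_def)
  have AS: "A \<inter> S = {}" "A \<inter> T = {}" "A \<inter> U = {}" "B \<inter> (S \<union> T \<union> U) = {}"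
    using K(5) by blast+
  have "a \<notin> P" "a \<notin> Q" "a \<notin> R" using h by (auto simp: hooked_def)
  moreover have "touch B (P \<union> S)" "touch B (Q \<union> T)" "touch B (R \<union> U)"
    using K(1-3) touch_mono[of B _ B] by auto
  moreover have "{a} \<inter> B = {}" using tr' K by blast
  moreover have "(P \<union> S) \<inter> (Q \<union> T) = {}" "(P \<union> S) \<inter> (R \<union> U) = {}" "(Q \<union> T) \<inter> (R \<union> U) = {}"
    using tr'(2,3,5) AS(1,2) K(6) apply blast
    using tr'(2,4,6) AS(1,3) K(7) apply blast
    using tr'(3,4,7) AS(2,3) K(8) by blast
  moreover have "({a} \<union> B) \<inter> (P \<union> S \<union> (Q \<union> T) \<union> (R \<union> U)) = {}"
    using tr'(1-4) AS K(4) calculation(1-3) by blast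
  ultimately have "K23_minor {a} B (P \<union> S) (Q \<union> T) (R \<union> U)"
    using K(9) conn_Un_hooked[OF h(1) c(1) e(4,7)] conn_Un_hooked[OF h(2) c(2) e(5,8)]
      conn_Un_hooked[OF h(3) c(3) e(6,9)] conn_singleton[of a]
    unfolding K23_minor_def by simp
  moreover have "a \<in> A" "P \<union> S \<union> (Q \<union> T) \<union> (R \<union> U) \<subseteq> A \<union> S \<union> T \<union> U"
    using tr by (auto simp: tripod_def)
  ultimately show ?thesis by blast
qed

lemma K23_minor_commute: "K23_minor A B S T U \<Longrightarrow> K23_minor B A S T U"
  by (auto simp: K23_minor_def)

text \<open>Both hubs are contracted in turn, since the arcs of a theta curve need single points as
  ends.\<close>

lemma K23_minor_singletons:
  assumes "K23_minor A B S T U" "finite A" "finite B"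
  shows "\<exists>a\<in>A. \<exists>b\<in>B. \<exists>S' T' U'. K23_minor {a} {b} S' T' U'
    \<and> S' \<union> T' \<union> U' \<subseteq> A \<union> B \<union> S \<union> T \<union> U"
proof -
  obtain a S' T' U' where 1: "a \<in> A" "K23_minor {a} B S' T' U'" "S' \<union> T' \<union> U' \<subseteq> A \<union> S \<union> T \<union> U"
    using K23_minor_contract_side[OF assms(1,2)] by blast
  obtain b S'' T'' U'' where "b \<in> B" "K23_minor {b} {a} S'' T'' U''"
    "S'' \<union> T'' \<union> U'' \<subseteq> B \<union> S' \<union> T' \<union> U'"
    using K23_minor_contract_side[OF K23_minor_commute[OF 1(2)] assms(3)] by blast
  then have "K23_minor {a} {b} S'' T'' U''" "S'' \<union> T'' \<union> U'' \<subseteq> A \<union> B \<union> S \<union> T \<union> U"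
    using K23_minor_commute 1(3) by blast+
  with \<open>a \<in> A\<close> \<open>b \<in> B\<close> show ?thesis by blast
qed

end
section \<open>Colouring graphs without such a minor\<close>

lemma avoid_colour:
  assumes "finite F" "card F \<le> 2"
  shows "\<exists>a\<in>{1..3 :: nat}. a \<notin> F"
proof (rule ccontr)
  assume "\<not> ?thesis"
  then have "{1..3} \<subseteq> F" by blast
  from card_mono[OF assms(1) this] assms(2) show False by simp
qed

lemma third_colour: "\<exists>a\<in>{1..3 :: nat}. a \<noteq> b \<and> a \<noteq> c"
  using avoid_colour[of "{b, c}"] by (auto simp: card_insert_if)

text \<open>This form lets three distinct members be turned into an excluded minor.\<close>

lemma card_le_2I:
  assumes "\<And>x y z. x \<in> A \<Longrightarrow> y \<in> A \<Longrightarrow> z \<in> A \<Longrightarrow> x \<noteq> y \<Longrightarrow> x \<noteq> z \<Longrightarrow> y \<noteq> z \<Longrightarrow> False"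
  shows "card A \<le> 2"
proof (rule ccontr)
  assume "\<not> card A \<le> 2"
  then have "3 \<le> card A" by simp
  then obtain B where "B \<subseteq> A" "card B = 3" by (metis obtain_subset_with_card_n)
  then obtain x y z where "B = {x, y, z}" "x \<noteq> y" "x \<noteq> z" "y \<noteq> z" by (auto simp: card_3_iff)
  then show False using assms[of x y z] \<open>B \<subseteq> A\<close> by auto
qed

locale K23_free_graph = sym_rel adj for adj :: "'a \<Rightarrow> 'a \<Rightarrow> bool" +
  fixes V :: "'a set"
  assumes finite_V: "finite V" and adj_V: "adj u v \<Longrightarrow> u \<in> V" and irrefl: "\<not> adj v v"
    and conn_V: "conn V" and card_V: "2 \<le> card V"
    and no_K23: "A \<union> B \<union> S \<union> T \<union> U \<subseteq> V \<Longrightarrow> \<not> K23_minor A B S T U"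
begin

lemma adj_V': "adj u v \<Longrightarrow> v \<in> V"
  using adj_V adj_sym by blast

lemma touched_conn_subset: "conn S \<Longrightarrow> touch A S \<Longrightarrow> S \<subseteq> V"
proof
  fix v assume S: "conn S" "touch A S" "v \<in> S"
  show "v \<in> V"
  proof (cases "S = {v}")
    case True
    then show ?thesis using S adj_V' by (auto simp: touch_def)
  next
    case False
    then show ?thesis using S conn_edge[of S "{v}"] adj_V by auto
  qed
qed

text \<open>Each branch set is connected and touches another one, so all its vertices lie on edges
  and containment in \<open>V\<close> is automatic.\<close>

lemma no_K23_minor: "\<not> K23_minor A B S T U"
proof
  assume K: "K23_minor A B S T U"
  then have "A \<union> B \<union> S \<union> T \<union> U \<subseteq> V"
    unfolding K23_minor_def by (meson Un_least touched_conn_subset touch_commute)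
  then show False using no_K23 K by blast
qed

lemma no_three_common:
  assumes "conn A" "conn B" "A \<inter> B = {}" "x \<noteq> y" "x \<noteq> z" "y \<noteq> z"
    and "x \<notin> A \<union> B" "y \<notin> A \<union> B" "z \<notin> A \<union> B"
    and "touch A {x}" "touch A {y}" "touch A {z}" "touch B {x}" "touch B {y}" "touch B {z}"
  shows False
  using no_K23_minor[of A B "{x}" "{y}" "{z}"] assms unfolding K23_minor_def
  by (simp add: conn_singleton)

lemma has_neighbour:
  assumes "v \<in> V"
  shows "\<exists>u. adj v u"
proof -
  have "V \<noteq> {v}" using card_V by auto
  then show ?thesis using conn_edge[OF conn_V, of "{v}"] assms by auto
qed

section \<open>Packed stars and admissible partial colourings\<close>

definition nbs :: "'a \<Rightarrow> 'a set" where
  "nbs v = {u. adj v u}"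

definition cover :: "'a set \<Rightarrow> 'a set" where
  "cover X = X \<union> (\<Union>x\<in>X. nbs x)"

text \<open>These are the vertices at distance two from \<open>X\<close>, since neighbours of
  \<open>X\<close> already belong to \<open>cover X\<close>.\<close>

definition rim :: "'a set \<Rightarrow> 'a set" where
  "rim X = {z. z \<notin> cover X \<and> touch (cover X) {z}}"

definition unique_in :: "('a \<Rightarrow> nat) \<Rightarrow> 'a set \<Rightarrow> 'a \<Rightarrow> 'a \<Rightarrow> bool" where
  "unique_in c S w y \<longleftrightarrow> y \<in> S \<and> adj w y \<and> (\<forall>y'\<in>S. adj w y' \<longrightarrow> y' \<noteq> y \<longrightarrow> c y' \<noteq> c y)"

text \<open>The invariant of the growth; \<open>c\<close> is meant as a colouring of the neighbours
  of \<open>X\<close>. The guard \<open>X \<noteq> {}\<close> lets the growth start from nothing, as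
  \<open>conn\<close> demands a nonempty set.\<close>

definition admissible :: "'a set \<Rightarrow> ('a \<Rightarrow> nat) \<Rightarrow> bool" where
  "admissible X c \<longleftrightarrow> X \<subseteq> V \<and> (X \<noteq> {} \<longrightarrow> conn (cover X))
     \<and> (\<forall>x\<in>X. \<forall>x'\<in>X. x \<noteq> x' \<longrightarrow> insert x (nbs x) \<inter> insert x' (nbs x') = {})
     \<and> range c \<subseteq> {1..3}
     \<and> (\<forall>w\<in>X \<union> rim X. \<exists>y. unique_in c (\<Union>x\<in>X. nbs x) w y)"

lemma finite_nbs: "finite (nbs v)"
  by (rule finite_subset[OF _ finite_V]) (auto simp: nbs_def adj_V')

lemma cover_subset: "X \<subseteq> V \<Longrightarrow> cover X \<subseteq> V"
  by (auto simp: cover_def nbs_def adj_V')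

lemma rim_subset: "rim X \<subseteq> V"
  by (auto simp: rim_def touch_def adj_V')

lemma conn_star: "conn (insert x (nbs x))"
  using conn_Un_family[OF conn_singleton[of x] finite_nbs[of x]] by (auto simp: touch_def nbs_def)

lemma conn_cover_rim:
  assumes "conn (cover X)" "R \<subseteq> rim X"
  shows "conn (cover X \<union> R)"
  using assms(2) by (intro conn_Un_family[OF assms(1)] finite_subset[OF _ finite_V])
    (auto simp: rim_def touch_def adj_V')

text \<open>Unless it is the first centre, \<open>x\<close> is at distance three from
  \<open>X\<close>. Its neighbours are coloured so that \<open>x\<close> and the newly reached
  vertices see a unique colour, while earlier rim vertices keep theirs.\<close>

lemma admissible_extend:
  assumes admissible: "admissible X c" and x: "x \<in> V" "x \<notin> cover X" "x \<notin> rim X"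
    and at: "X = {} \<or> (\<exists>n\<in>rim X. adj x n)"
  shows "\<exists>c'. admissible (insert x X) c'"
proof -
  define B where "B = cover X"
  define Y where "Y = (\<Union>x\<in>X. nbs x)"
  define N where "N = nbs x"
  \<comment> \<open>\<open>Old\<close> vertices have a unique colour that must survive;
    \<open>New\<close> vertices have no neighbour in \<open>B\<close> and depend on \<open>N\<close>
    alone.\<close>
  define Old where "Old = rim X - N"
  define New where "New = {z. z \<notin> B \<and> z \<notin> rim X \<and> z \<notin> N \<and> z \<noteq> x \<and> touch N {z}}"
  have XV: "X \<subseteq> V" and conn_B: "X \<noteq> {} \<Longrightarrow> conn B"
    and pack: "\<And>x x'. x \<in> X \<Longrightarrow> x' \<in> X \<Longrightarrow> x \<noteq> x' \<Longrightarrow> insert x (nbs x) \<inter> insert x' (nbs x') = {}"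
    and c_range: "\<And>v. c v \<in> {1..3}"
    and ex_unique: "\<And>w. w \<in> X \<union> rim X \<Longrightarrow> \<exists>y. unique_in c Y w y"
    using admissible unfolding admissible_def B_def Y_def by blast+
  then obtain f where f: "\<And>w. w \<in> X \<union> rim X \<Longrightarrow> unique_in c Y w (f w)" by metis
  have YB: "Y \<subseteq> B" and XB: "X \<subseteq> B" and B: "B = X \<union> Y" by (auto simp: Y_def B_def cover_def)
  have NB: "N \<inter> B = {}"
    using x adj_sym unfolding N_def nbs_def B_def rim_def touch_def by blast
  have xN: "x \<notin> N" using irrefl by (simp add: N_def nbs_def)
  have xB: "x \<notin> B" using x by (simp add: B_def)
  have adj_N: "adj x y" "adj y x" if "y \<in> N" for y
    using that adj_sym by (auto simp: N_def nbs_def)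
  have Old: "z \<notin> B" "z \<notin> N" "z \<noteq> x" "touch B {z}" "z \<in> rim X" if "z \<in> Old" for z
    using that x by (auto simp: Old_def rim_def B_def)
  have New: "z \<notin> B" "z \<notin> N" "z \<noteq> x" "\<not> touch B {z}" if "z \<in> New" for z
    using that by (auto simp: New_def rim_def B_def)
  have cover': "cover (insert x X) = insert x (B \<union> N)"
    by (auto simp: cover_def B_def N_def)
  have nbs': "(\<Union>x\<in>insert x X. nbs x) = Y \<union> N" by (auto simp: Y_def N_def)
  have rim': "rim (insert x X) \<subseteq> Old \<union> New"
    using adj_N by (auto simp: rim_def[of "insert x X"] cover' Old_def New_def touch_def B_def rim_def N_def nbs_def)
  have X_ne: "X \<noteq> {}" if "z \<in> rim X" for z
    using that by (auto simp: rim_def cover_def touch_def)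
  \<comment> \<open>Otherwise \<open>w\<close> and \<open>x\<close> have three common
    neighbours.\<close>
  have two_in_N: "False"
    if "w \<noteq> x" "w \<notin> N" "{a, b, d} \<subseteq> N" "a \<noteq> b" "a \<noteq> d" "b \<noteq> d" "adj w a" "adj w b" "adj w d"
    for w a b d
    using no_three_common[of "{w}" "{x}" a b d] that xN adj_N conn_singleton
    by (auto simp: touch_def)
  \<comment> \<open>The colours forbidden at \<open>y\<close>: each is the unique colour of some
    \<open>Old\<close> neighbour of \<open>y\<close> and would be repeated there.\<close>
  define F where "F y = (\<lambda>z. c (f z)) ` {z \<in> Old. adj z y}" for y
  have fin_Old: "finite Old"
    unfolding Old_def using finite_subset[OF rim_subset finite_V] by blast
  \<comment> \<open>Three such neighbours would all touch both \<open>B\<close> and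
    \<open>{y}\<close>.\<close>
  have Old_nb: "card {z \<in> Old. adj z y} \<le> 2" if "y \<in> N" for y
  proof (rule card_le_2I)
    fix u v w
    assume *: "u \<in> {z \<in> Old. adj z y}" "v \<in> {z \<in> Old. adj z y}" "w \<in> {z \<in> Old. adj z y}"
      "u \<noteq> v" "u \<noteq> w" "v \<noteq> w"
    then have "conn B" using Old X_ne conn_B by blast
    moreover have "y \<notin> B" "u \<noteq> y" "v \<noteq> y" "w \<noteq> y" using * Old that NB by blast+
    moreover have "touch {y} {u}" "touch {y} {v}" "touch {y} {w}"
      using * adj_sym by (auto simp: touch_def)
    ultimately show False
      using no_three_common[of B "{y}" u v w] * Old conn_singleton[of y] by simp
  qed
  have fin_F: "finite (F y)" for y
    using fin_Old by (simp add: F_def)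
  have card_F_le: "card (F y) \<le> card {z \<in> Old. adj z y}" for y
    unfolding F_def using fin_Old by (intro card_image_le) simp
  \<comment> \<open>The colours given so far restrict only \<open>y1\<close> and \<open>y2\<close>: both \<open>B \<union> Old\<close> and \<open>x\<close> are joined to every
    restricted vertex. The colour of \<open>y1\<close> becomes the unique one for \<open>x\<close>.\<close>
  obtain y1 y2 where y12: "y1 \<in> N" "y2 \<in> N"
    and contact: "\<And>y. y \<in> N \<Longrightarrow> touch (B \<union> Old) {y} \<Longrightarrow> y = y1 \<or> y = y2"
  proof (cases "X = {}")
    case True
    then have "B \<union> Old = {}" by (auto simp: B_def Old_def rim_def cover_def touch_def)
    moreover obtain y where "y \<in> N" using has_neighbour[OF x(1)] by (auto simp: N_def nbs_def)
    ultimately show ?thesis using that[of y y] by (auto simp: touch_def)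
  next
    case False
    define K where "K = {y \<in> N. touch (B \<union> Old) {y}}"
    have conn: "conn (B \<union> Old)"
      using conn_cover_rim[of X Old] conn_B[OF False] by (auto simp: B_def Old_def)
    have "card K \<le> 2"
      unfolding K_def
    proof (rule card_le_2I)
      fix u v w assume *: "u \<in> {y \<in> N. touch (B \<union> Old) {y}}"
        "v \<in> {y \<in> N. touch (B \<union> Old) {y}}" "w \<in> {y \<in> N. touch (B \<union> Old) {y}}" "u \<noteq> v" "u \<noteq> w" "v \<noteq> w"
      then have "touch {x} {u}" "touch {x} {v}" "touch {x} {w}" using adj_N by (auto simp: touch_def)
      moreover have "u \<notin> B \<union> Old \<union> {x}" "v \<notin> B \<union> Old \<union> {x}" "w \<notin> B \<union> Old \<union> {x}"
        using * NB xN Old(2) by blast+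
      moreover have "(B \<union> Old) \<inter> {x} = {}" using xB Old(3) by blast
      ultimately show False
        using no_three_common[of "B \<union> Old" "{x}" u v w] conn conn_singleton[of x] * by simp
    qed
    \<comment> \<open>By \<open>at\<close>, the set \<open>K\<close> is nonempty. If
      \<open>n\<close> is its only element, it serves as both \<open>y1\<close> and
      \<open>y2\<close>.\<close>
    obtain n where "n \<in> rim X" "adj x n" using at False by blast
    then have n: "n \<in> K" by (auto simp: K_def N_def nbs_def rim_def B_def touch_def)
    have "finite (K - {n})" using finite_nbs by (simp add: K_def N_def)
    moreover have "card (K - {n}) \<le> Suc 0"
      using \<open>card K \<le> 2\<close> card_Diff_singleton[OF n] by linarith
    ultimately have same: "\<forall>a\<in>K - {n}. \<forall>b\<in>K - {n}. a = b"
      by (simp only: card_le_Suc0_iff_eq)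
    show ?thesis
    proof (cases "K - {n} = {}")
      case True
      then show ?thesis using that[of n n] n unfolding K_def by blast
    next
      case False
      then obtain m where "m \<in> K - {n}" by blast
      then show ?thesis using that[of n m] n same unfolding K_def by blast
    qed
  qed
  have Old_two: "\<exists>u v. u \<in> Old \<and> v \<in> Old \<and> adj u y \<and> adj v y \<and> u \<noteq> v" if "2 \<le> card (F y)" for y
  proof -
    have "\<not> card {z \<in> Old. adj z y} \<le> Suc 0" using that card_F_le[of y] by simp
    then show ?thesis using fin_Old by (auto simp: card_le_Suc0_iff_eq)
  qed
  \<comment> \<open>Let \<open>z1\<close>, \<open>z2\<close> be \<open>Old\<close> neighbours of
    \<open>y1\<close>. If those found for \<open>y2\<close> are the same, \<open>y1\<close> and
    \<open>y2\<close> share \<open>x\<close>, \<open>z1\<close>, \<open>z2\<close>. Otherwise a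
    further \<open>w\<close> next to \<open>y2\<close> makes \<open>{w, x, y2}\<close> a third
    branch set between \<open>{y1}\<close> and \<open>B\<close>.\<close>
  have not_both: False
    if ne: "y1 \<noteq> y2" and y1: "2 \<le> card (F y1)" and y2: "2 \<le> card (F y2)"
  proof -
    obtain z1 z2 where z: "z1 \<in> Old" "z2 \<in> Old" "adj z1 y1" "adj z2 y1" "z1 \<noteq> z2"
      using Old_two[OF y1] by blast
    obtain w1 w2 where w: "w1 \<in> Old" "w2 \<in> Old" "adj w1 y2" "adj w2 y2" "w1 \<noteq> w2"
      using Old_two[OF y2] by blast
    have cB: "conn B" using z(1) Old X_ne conn_B by blast
    show False
    proof (cases "{w1, w2} \<subseteq> {z1, z2}")
      case True
      then have "adj z1 y2" "adj z2 y2" using w by auto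
      then show ?thesis
        using no_three_common[of "{y1}" "{y2}" x z1 z2] z ne y12 xN adj_N[OF y12(1)] adj_N[OF y12(2)]
          conn_singleton Old(2,3)[OF z(1)] Old(2,3)[OF z(2)] adj_sym[OF z(3)] adj_sym[OF z(4)]
          adj_sym[of z1 y2] adj_sym[of z2 y2]
        by (auto simp: touch_def)
    next
      case False
      then obtain w where w: "w \<in> Old" "adj w y2" "w \<noteq> z1" "w \<noteq> z2" using w by blast
      have "conn {x, y2}" using conn_insert[OF conn_singleton[of y2], of x] adj_N[OF y12(2)]
        by (simp add: touch_def)
      then have "conn (insert w {x, y2})"
        using conn_insert[of "{x, y2}" w] w(2) adj_sym[OF w(2)] by (simp add: touch_def)
      moreover have "touch {y1} {z1}" "touch {y1} {z2}" "touch {y1} {w, x, y2}" "touch B {w, x, y2}"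
        using adj_sym[OF z(3)] adj_sym[OF z(4)] adj_N[OF y12(1)] Old(4)[OF w(1)]
        by (auto simp: touch_def)
      moreover have "({y1} \<union> B) \<inter> ({z1} \<union> {z2} \<union> {w, x, y2}) = {}" "y1 \<notin> B"
        using y12 ne xN xB NB Old(1,2)[OF z(1)] Old(1,2)[OF z(2)] Old(1,2)[OF w(1)] by blast+
      moreover have "{z1} \<inter> {w, x, y2} = {}" "{z2} \<inter> {w, x, y2} = {}"
        using y12 w Old(2,3)[OF z(1)] Old(2,3)[OF z(2)] by blast+
      ultimately have "K23_minor {y1} B {z1} {z2} {w, x, y2}"
        using z(5) conn_singleton cB Old(4)[OF z(1)] Old(4)[OF z(2)]
        unfolding K23_minor_def by simp
      then show ?thesis using no_K23_minor by blast
    qed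
  qed
  \<comment> \<open>By \<open>not_both\<close>, if \<open>y1\<close> and \<open>y2\<close> differ,
    one of them has two of the three colours available, so distinct choices exist.\<close>
  obtain \<alpha> \<beta> where \<alpha>\<beta>: "\<alpha> \<in> {1..3}" "\<beta> \<in> {1..3}" "\<alpha> \<noteq> \<beta>" "\<alpha> \<notin> F y1"
    "y1 \<noteq> y2 \<Longrightarrow> \<beta> \<notin> F y2"
  proof -
    have F2: "card (F y1) \<le> 2" "card (F y2) \<le> 2"
      using Old_nb[OF y12(1)] Old_nb[OF y12(2)] card_F_le[of y1] card_F_le[of y2] by linarith+
    have av: "\<exists>a\<in>{1..3}. a \<notin> insert b (F y)" if "card (F y) \<le> 1" for b y
      using that fin_F by (intro avoid_colour) (auto simp: card_insert_if)
    consider (same) "y1 = y2" | (one) "card (F y1) \<le> 1" | (two) "card (F y2) \<le> 1"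
      using not_both by fastforce
    then show ?thesis
    proof cases
      case same
      obtain a where a: "a \<in> {1..3}" "a \<notin> F y1" using avoid_colour[OF fin_F F2(1)] ..
      obtain b where "b \<in> {1..3}" "b \<noteq> a" using third_colour[of a a] by blast
      then show ?thesis using that[OF a(1), of b] a same by blast
    next
      case one
      obtain b where b: "b \<in> {1..3}" "b \<notin> F y2" using avoid_colour[OF fin_F F2(2)] ..
      obtain a where "a \<in> {1..3}" "a \<notin> insert b (F y1)" using av[OF one] ..
      then show ?thesis using that[of a b] b by blast
    next
      case two
      obtain a where a: "a \<in> {1..3}" "a \<notin> F y1" using avoid_colour[OF fin_F F2(1)] ..
      obtain b where "b \<in> {1..3}" "b \<notin> insert a (F y2)" using av[OF two] ..
      then show ?thesis using that[OF a(1), of b] a by blast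
    qed
  qed
  obtain \<gamma> where \<gamma>: "\<gamma> \<in> {1..3}" "\<gamma> \<noteq> \<alpha>" "\<gamma> \<noteq> \<beta>"
    using third_colour[of \<alpha> \<beta>] by blast
  \<comment> \<open>A vertex of \<open>New\<close> has at most two neighbours in \<open>Y \<union> N\<close>, and they must differ. These pairs form
    a forest because a cycle together with \<open>x\<close> contains the excluded minor.\<close>
  define P where "P u v \<longleftrightarrow> u \<noteq> v \<and> (\<exists>z\<in>New. adj z u \<and> adj z v)" for u v
  \<comment> \<open>\<open>y1\<close> is left out: \<open>\<alpha>\<close> is reserved for it, and
    the rest of \<open>N\<close> must do with two colours.\<close>
  define S where "S = N - {y1}"
  have "\<exists>d :: 'a \<Rightarrow> bool. \<forall>u\<in>S. \<forall>v\<in>S. P u v \<longrightarrow> d u \<noteq> d v"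
  proof (rule two_coloring)
    show "finite S" using finite_nbs by (simp add: S_def N_def)
    show "P v u" if "P u v" for u v using that by (auto simp: P_def)
    show "\<not> P u u" for u by (simp add: P_def)
    fix u v w assume S: "u \<in> S" "v \<in> S" "w \<in> S" and P: "P u v" "P u w" and "v \<noteq> w"
    show "\<not> reach_in P (S - {u}) v w"
    proof
      assume reach: "reach_in P (S - {u}) v w"
      obtain z where z: "z \<in> New" "adj z u" "adj z v" "u \<noteq> v" using P(1) by (auto simp: P_def)
      obtain z' where z': "z' \<in> New" "adj z' u" "adj z' w" "u \<noteq> w" using P(2) by (auto simp: P_def)
      have N: "u \<in> N" "v \<in> N" "w \<in> N" using S by (auto simp: S_def)
      have "z \<noteq> z'" using two_in_N[of z u v w] New[OF z(1)] N z z' \<open>v \<noteq> w\<close> by auto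
      \<comment> \<open>By \<open>two_in_N\<close>, a \<open>New\<close> vertex joining two vertices
        of \<open>N - {u}\<close> is not adjacent to \<open>u\<close>. So the walk from
        \<open>v\<close> to \<open>w\<close> yields a connected set avoiding \<open>z\<close> and
        \<open>z'\<close>, which shares the contacts \<open>x\<close>, \<open>z\<close>,
        \<open>z'\<close> with \<open>{u}\<close>.\<close>
      let ?W = "N - {u} \<union> {q \<in> New. \<not> adj q u}"
      have "\<exists>T\<subseteq>?W. conn T \<and> v \<in> T \<and> w \<in> T" using reach
      proof (induction rule: rtranclp_induct)
        case base
        show ?case using N z conn_singleton[of v] by (intro exI[of _ "{v}"]) auto
      next
        case (step a b)
        then obtain T where T: "T \<subseteq> ?W" "conn T" "v \<in> T" "a \<in> T" by blast
        obtain q where q: "q \<in> New" "adj q a" "adj q b" "a \<noteq> b" using step by (auto simp: P_def)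
        have ab: "a \<in> N" "b \<in> N" "a \<noteq> u" "b \<noteq> u" using step by (auto simp: S_def)
        have "\<not> adj q u" using two_in_N[of q u a b] New[OF q(1)] N q ab by auto
        moreover have "conn (insert b (insert q T))"
        proof (rule conn_insert)
          show "conn (insert q T)" using T(2,4) adj_sym[OF q(2)] conn_insert touchI by blast
          show "touch (insert q T) {b}" using q(3) by (simp add: touch_def)
        qed
        ultimately show ?case
          using T q ab by (intro exI[of _ "insert b (insert q T)"]) auto
      qed
      then obtain T where T: "T \<subseteq> ?W" "conn T" "v \<in> T" "w \<in> T" by blast
      have x_T: "x \<notin> T" "z \<notin> T" "z' \<notin> T" "u \<notin> T"
        using T(1) xN z z' New N by auto
      have "touch T {x}" "touch T {z}" "touch T {z'}"
        using T z z' adj_sym adj_N N unfolding touch_def by blast+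
      moreover have "touch {u} {x}" "touch {u} {z}" "touch {u} {z'}"
        using z z' adj_sym adj_N N unfolding touch_def by blast+
      ultimately show False
        using no_three_common[OF conn_singleton[of u] T(2), of x z z'] x_T \<open>z \<noteq> z'\<close>
          New[OF z(1)] New[OF z'(1)] N xN by auto
    qed
  qed
  then obtain d :: "'a \<Rightarrow> bool" where d: "\<And>u v. u \<in> S \<Longrightarrow> v \<in> S \<Longrightarrow> P u v \<Longrightarrow> d u \<noteq> d v"
    by blast
  \<comment> \<open>The classes of \<open>d\<close> are named so that \<open>y2\<close> gets
    \<open>\<beta>\<close> if it differs from \<open>y1\<close>.\<close>
  define c' where "c' v = (if v \<notin> N then c v else if v = y1 then \<alpha> else if d v = d y2 then \<beta> else \<gamma>)" for v
  have c'_Y: "c' y = c y" if "y \<in> Y" for y using that NB YB by (auto simp: c'_def)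
  have c'_y1: "c' y1 = \<alpha>" using y12 by (simp add: c'_def)
  have c'_y2: "c' y2 = \<beta>" if "y1 \<noteq> y2" using that y12 by (simp add: c'_def)
  have c'_ne: "c' y \<noteq> \<alpha>" if "y \<in> N" "y \<noteq> y1" for y using that \<alpha>\<beta> \<gamma> by (simp add: c'_def)
  have c'_P: "c' u \<noteq> c' v" if "u \<in> N" "v \<in> N" "P u v" for u v
  proof (cases "u = y1 \<or> v = y1")
    case True
    then show ?thesis using c'_y1 c'_ne that by (metis P_def)
  next
    case False
    then have "d u \<noteq> d v" using d that by (auto simp: S_def)
    then show ?thesis using False that \<gamma> by (auto simp: c'_def)
  qed
  have ext_unique: "\<exists>y. unique_in c' (Y \<union> N) w y" if w: "w \<in> insert x X \<union> rim (insert x X)" for w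
  proof -
    \<comment> \<open>\<open>x\<close> is served by \<open>y1\<close>. Vertices of \<open>X\<close>
      have no neighbour in \<open>N\<close>; \<open>Old\<close> vertices see at most
      \<open>y1\<close> and \<open>y2\<close> there, whose colours avoid \<open>F\<close>. For a
      \<open>New\<close> vertex any neighbour in \<open>N\<close> works, since all of them differ in
      colour.\<close>
    consider "w = x" | "w \<in> X" | "w \<in> Old" | "w \<in> New" using w rim' by blast
    then show ?thesis
    proof cases
      case 1
      have "y \<in> N" if "adj x y" for y using that by (simp add: N_def nbs_def)
      then have "unique_in c' (Y \<union> N) x y1"
        using y12 adj_N c'_y1 c'_ne by (auto simp: unique_in_def)
      then show ?thesis using 1 by blast
    next
      case 2
      then have "y \<notin> N" if "adj w y" for y
        using that NB by (auto simp: B_def cover_def nbs_def)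
      then have "unique_in c' (Y \<union> N) w (f w)"
        using f[of w] 2 c'_Y by (auto simp: unique_in_def)
      then show ?thesis by blast
    next
      case 3
      have fw: "unique_in c Y w (f w)" using f Old(5)[OF 3] by blast
      have "c' y \<noteq> c (f w)" if "y \<in> N" "adj w y" for y
      proof -
        have "touch (B \<union> Old) {y}" using 3 that by (auto simp: touch_def)
        then have "y = y1 \<or> y = y2" using contact that by blast
        moreover have "c (f w) \<in> F y" using 3 that by (auto simp: F_def)
        ultimately show ?thesis using c'_y1 c'_y2 \<alpha>\<beta> by metis
      qed
      then have "unique_in c' (Y \<union> N) w (f w)"
        using fw c'_Y unfolding unique_in_def by auto
      then show ?thesis by blast
    next
      case 4
      have nY: "y \<notin> Y" if "adj w y" for y
        using New[OF 4] that YB adj_sym unfolding touch_def by blast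
      obtain y where y: "y \<in> N" "adj w y" using 4 adj_sym by (auto simp: New_def touch_def)
      have "c' y' \<noteq> c' y" if "y' \<in> N" "adj w y'" "y' \<noteq> y" for y'
        using c'_P[of y' y] that y 4 by (auto simp: P_def)
      then have "unique_in c' (Y \<union> N) w y" using y nY by (auto simp: unique_in_def)
      then show ?thesis by blast
    qed
  qed
  have ext_conn: "conn (cover (insert x X))"
  proof (cases "X = {}")
    case True
    then show ?thesis using conn_star[of x] by (simp add: cover_def)
  next
    case False
    then obtain n where n: "n \<in> rim X" "adj x n" using at by blast
    then have "touch B (insert x N)"
      by (auto simp: rim_def B_def[symmetric] touch_def N_def nbs_def)
    then have "conn (B \<union> insert x N)"
      using conn_Un[OF conn_B[OF False] conn_star[of x]] by (simp add: N_def)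
    then show ?thesis by (simp add: cover')
  qed
  have "insert x (nbs x) \<inter> insert x' (nbs x') = {}" if "x' \<in> X" for x'
  proof -
    have "insert x' (nbs x') \<subseteq> B" using that by (auto simp: B_def cover_def)
    then show ?thesis using NB xB unfolding N_def by blast
  qed
  then have ext_pack: "insert u (nbs u) \<inter> insert v (nbs v) = {}"
    if "u \<in> insert x X" "v \<in> insert x X" "u \<noteq> v" for u v
    using that pack[of u v] by (metis inf_commute insertE)
  have "range c' \<subseteq> {1..3}"
    using c_range \<alpha>\<beta> \<gamma> by (auto simp: c'_def)
  then have "admissible (insert x X) c'"
    using ext_unique ext_conn ext_pack x(1) XV by (simp only: admissible_def nbs' insert_subset) simp
  then show ?thesis by blast
qed

section \<open>Maximal packing and the full colouring\<close>

text \<open>For a maximal \<open>X\<close>, an edge leaving \<open>cover X \<union> rim X\<close>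
  would start in the rim, because neighbours of the cover are in the cover or the rim. Its far end
  could then be added to \<open>X\<close>.\<close>

lemma admissible_cover_exists: "\<exists>X c. admissible X c \<and> V = cover X \<union> rim X"
proof -
  let ?G = "{X. \<exists>c. admissible X c}"
  have "finite ?G" by (rule finite_subset[of _ "Pow V"]) (use finite_V in \<open>auto simp: admissible_def\<close>)
  moreover have "rim {} = {}" by (simp add: rim_def cover_def touch_def)
  then have "admissible {} (\<lambda>_. 1)" by (simp add: admissible_def)
  then have "?G \<noteq> {}" by blast
  ultimately obtain X where "X \<in> ?G" and "\<forall>X'\<in>?G. X \<subseteq> X' \<longrightarrow> X = X'"
    using finite_has_maximal[of ?G] by metis
  then obtain c where admissible: "admissible X c" and max: "\<And>X' c'. admissible X' c' \<Longrightarrow> X \<subseteq> X' \<Longrightarrow> X = X'"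
    by auto
  have XV: "X \<subseteq> V" using admissible by (simp add: admissible_def)
  have stuck: False if "x \<in> V" "x \<notin> cover X" "x \<notin> rim X" "X = {} \<or> (\<exists>n\<in>rim X. adj x n)" for x
  proof -
    have "X = insert x X" using admissible_extend[OF admissible that] max by blast
    then show False using that(2) by (auto simp: cover_def)
  qed
  have "V \<subseteq> cover X \<union> rim X"
  proof (rule ccontr)
    assume *: "\<not> ?thesis"
    show False
    proof (cases "X = {}")
      case True
      then show False using stuck * by blast
    next
      case False
      then have "cover X \<union> rim X \<noteq> {}" by (auto simp: cover_def)
      then obtain z x where zx: "z \<in> cover X \<union> rim X" "x \<in> V - (cover X \<union> rim X)" "adj z x"
        using conn_edge[OF conn_V, of "cover X \<union> rim X"] * cover_subset[OF XV] rim_subset by auto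
      then have "z \<notin> cover X" by (auto simp: rim_def touch_def)
      then show False using stuck[of x] zx adj_sym by blast
    qed
  qed
  then show ?thesis using admissible cover_subset[OF XV] rim_subset by blast
qed

theorem complete_cf_4_colouring:
  "\<exists>C. (\<forall>v\<in>V. C v \<in> {1..4 :: nat})
    \<and> (\<forall>v\<in>V. \<exists>u. adj v u \<and> (\<forall>u'. adj v u' \<longrightarrow> C u' = C u \<longrightarrow> u' = u))"
proof -
  obtain X c where admissible: "admissible X c" and V: "V = cover X \<union> rim X"
    using admissible_cover_exists by blast
  define Y where "Y = (\<Union>x\<in>X. nbs x)"
  define Z where "Z = rim X"
  have XV: "X \<subseteq> V" and conn: "X \<noteq> {} \<Longrightarrow> conn (cover X)"
    and pack: "\<And>x x'. x \<in> X \<Longrightarrow> x' \<in> X \<Longrightarrow> x \<noteq> x' \<Longrightarrow> insert x (nbs x) \<inter> insert x' (nbs x') = {}"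
    and c_range: "\<And>v. c v \<in> {1..3}"
    and ex_unique: "\<And>w. w \<in> X \<union> Z \<Longrightarrow> \<exists>y. unique_in c Y w y"
    using admissible unfolding admissible_def Y_def Z_def by blast+
  from ex_unique obtain f where f: "\<And>w. w \<in> X \<union> Z \<Longrightarrow> unique_in c Y w (f w)" by metis
  have cov: "cover X = X \<union> Y" by (simp add: cover_def Y_def)
  have XY: "X \<inter> Y = {}"
  proof -
    have "x \<notin> nbs x'" if "x \<in> X" "x' \<in> X" for x x'
      using that pack[of x x'] irrefl by (cases "x = x'") (auto simp: nbs_def)
    then show ?thesis by (auto simp: Y_def)
  qed
  have ZXY: "Z \<inter> (X \<union> Y) = {}" by (auto simp: Z_def rim_def cov)
  have nb_X: "y \<in> Y" if "x \<in> X" "adj x y" for x y using that by (auto simp: Y_def nbs_def)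
  \<comment> \<open>Every vertex of \<open>Z\<close> touches \<open>cover X\<close>, so three
    neighbours of \<open>w\<close> in \<open>Z\<close> would join \<open>cover X\<close> and
    \<open>{w}\<close>.\<close>
  have "card {z \<in> Z. adj w z} \<le> 2" if "w \<in> Z" for w
  proof (rule card_le_2I)
    fix a b d assume *: "a \<in> {z \<in> Z. adj w z}" "b \<in> {z \<in> Z. adj w z}" "d \<in> {z \<in> Z. adj w z}"
      "a \<noteq> b" "a \<noteq> d" "b \<noteq> d"
    have "X \<noteq> {}" using that by (auto simp: Z_def rim_def cover_def touch_def)
    moreover have "touch (cover X) {z} \<and> z \<notin> cover X" if "z \<in> Z" for z
      using that by (auto simp: Z_def rim_def)
    moreover have "touch {w} {a}" "touch {w} {b}" "touch {w} {d}" "a \<noteq> w" "b \<noteq> w" "d \<noteq> w"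
      using * irrefl by (auto simp: touch_def)
    ultimately show False
      using no_three_common[OF conn conn_singleton[of w], of a b d] * that by auto
  qed
  then have "card ((\<lambda>z. c (f z)) ` {z \<in> Z. adj w z}) \<le> 2" if "w \<in> Z" for w
    using that card_image_le[of "{z \<in> Z. adj w z}" "\<lambda>z. c (f z)"]
      finite_subset[OF rim_subset finite_V] by (fastforce simp: Z_def)
  \<comment> \<open>The forbidden colours come from \<open>c\<close> and \<open>f\<close> only, so
    the vertices of \<open>Z\<close> are coloured independently of each other.\<close>
  then have "\<exists>a\<in>{1..3}. a \<notin> (\<lambda>z. c (f z)) ` {z \<in> Z. adj w z}" if "w \<in> Z" for w
    using that finite_subset[OF rim_subset finite_V] by (intro avoid_colour) (auto simp: Z_def)
  then obtain g where g: "\<And>w. w \<in> Z \<Longrightarrow> g w \<in> {1..3}"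
    "\<And>w z. w \<in> Z \<Longrightarrow> z \<in> Z \<Longrightarrow> adj w z \<Longrightarrow> g w \<noteq> c (f z)"
    by (metis (mono_tags, lifting) image_eqI mem_Collect_eq)
  define C where "C v = (if v \<in> X then 4 else if v \<in> Y then c v else g v)" for v
  have CX: "C v = 4" if "v \<in> X" for v using that by (simp add: C_def)
  have CY: "C v = c v" if "v \<in> Y" for v using that XY by (auto simp: C_def)
  have CZ: "C v = g v" if "v \<in> Z" for v using that ZXY by (auto simp: C_def)
  have le3: "C v \<in> {1..3}" if "v \<in> Y \<union> Z" for v using that CY CZ c_range g by auto
  have cases: "v \<in> X \<or> v \<in> Y \<or> v \<in> Z" if "v \<in> V" for v using that V by (auto simp: Z_def cov)
  have "C v \<in> {1..4}" if "v \<in> V" for v using cases[OF that] CX le3[of v] by auto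
  moreover have "\<exists>u. adj v u \<and> (\<forall>u'. adj v u' \<longrightarrow> C u' = C u \<longrightarrow> u' = u)" if "v \<in> V" for v
    using cases[OF that]
  proof (elim disjE)
    assume v: "v \<in> X"
    then have "unique_in c Y v (f v)" using f by blast
    then show ?thesis using nb_X[OF v] CY unfolding unique_in_def by metis
  next
    assume v: "v \<in> Y"
    then obtain x where x: "x \<in> X" "adj x v" by (auto simp: Y_def nbs_def)
    \<comment> \<open>Colour 4 occurs only on \<open>X\<close>, and two centres with the common
      neighbour \<open>v\<close> would violate \<open>pack\<close>.\<close>
    have "u = x" if "adj v u" "C u = C x" for u
    proof -
      have "u \<in> X" using cases[OF adj_V'[OF that(1)]] that(2) CX[OF x(1)] le3[of u] by auto
      then show ?thesis using pack[of u x] x adj_sym[OF that(1)] by (auto simp: nbs_def)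
    qed
    then show ?thesis using x adj_sym by blast
  next
    assume v: "v \<in> Z"
    then have fv: "unique_in c Y v (f v)" using f by blast
    \<comment> \<open>\<open>u\<close> is not in \<open>X\<close>, as its neighbour \<open>v\<close>
      would lie in \<open>Y\<close>. In \<open>Y\<close> the colour of \<open>f v\<close> is unique,
      and in \<open>Z\<close> the choice of \<open>g u\<close> avoids it.\<close>
    have "u = f v" if "adj v u" "C u = C (f v)" for u
      using cases[OF adj_V'[OF that(1)]]
    proof (elim disjE)
      assume "u \<in> X"
      then show ?thesis using nb_X[of u v] adj_sym[OF that(1)] v ZXY by blast
    next
      assume "u \<in> Y"
      then show ?thesis using fv that CY unfolding unique_in_def by metis
    next
      assume u: "u \<in> Z"
      then show ?thesis using g(2)[OF u v adj_sym[OF that(1)]] that(2) CZ[OF u] CY fv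
        unfolding unique_in_def by metis
    qed
    then show ?thesis using fv unfolding unique_in_def by blast
  qed
  ultimately show ?thesis by blast
qed

end

section \<open>Theta curves\<close>

lemma arcs_winding_number:
  assumes "arc g" "arc h" "pathstart g = a" "pathfinish g = b" "pathstart h = a" "pathfinish h = b"
    and "z \<notin> path_image g \<union> path_image h"
  shows "winding_number (g +++ reversepath h) z = winding_number g z - winding_number h z"
  using assms by (simp add: winding_number_join winding_number_reversepath arc_imp_path)

lemma two_arcs_simple_loop:
  assumes "arc g" "arc h" "pathstart g = a" "pathfinish g = b" "pathstart h = a" "pathfinish h = b"
    and "path_image g \<inter> path_image h \<subseteq> {a, b}"
  shows "simple_path (g +++ reversepath h)" "pathfinish (g +++ reversepath h) = pathstart (g +++ reversepath h)"
    "path_image (g +++ reversepath h) = path_image g \<union> path_image h"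
  using assms by (auto simp: simple_path_join_loop_eq arc_reversepath path_image_join)

text \<open>Outside the loops with \<open>k\<close>, the winding number of \<open>k\<close> at
  \<open>z\<close> equals those of \<open>g\<close> and \<open>h\<close>. Then the loop of
  \<open>g\<close> and \<open>h\<close> has winding number 0 at \<open>z\<close>, but inside a
  simple loop its norm is 1.\<close>

lemma theta_inside_winding:
  fixes g h :: "real \<Rightarrow> complex"
  assumes arcs: "arc g" "arc h" "arc k"
    and ends: "pathstart g = a" "pathfinish g = b" "pathstart h = a" "pathfinish h = b"
      "pathstart k = a" "pathfinish k = b"
    and disj: "path_image g \<inter> path_image h \<subseteq> {a, b}" "path_image g \<inter> path_image k \<subseteq> {a, b}"
      "path_image h \<inter> path_image k \<subseteq> {a, b}"
    and out: "path_image k \<inter> inside (path_image g \<union> path_image h) = {}"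
    and z: "z \<in> inside (path_image g \<union> path_image h)"
  shows "z \<in> inside (path_image g \<union> path_image k) \<or> z \<in> inside (path_image h \<union> path_image k)"
proof (rule ccontr)
  assume not: "\<not> ?thesis"
  have zn: "z \<notin> path_image g \<union> path_image h" using z inside_no_overlap by blast
  have zk: "z \<notin> path_image k" using out z by blast
  note gh = two_arcs_simple_loop[OF arcs(1,2) ends(1-4) disj(1)]
  note gk = two_arcs_simple_loop[OF arcs(1,3) ends(1,2,5,6) disj(2)]
  note hk = two_arcs_simple_loop[OF arcs(2,3) ends(3-6) disj(3)]
  have "z \<in> outside (path_image g \<union> path_image k)" "z \<in> outside (path_image h \<union> path_image k)"
    using not zn zk inside_Un_outside by blast+
  then have "winding_number (g +++ reversepath k) z = 0" "winding_number (h +++ reversepath k) z = 0"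
    using gk hk by (intro winding_number_zero_in_outside; simp add: simple_path_imp_path)+
  then have "winding_number g z = winding_number h z"
    using arcs_winding_number[OF arcs(1,3) ends(1,2,5,6)] arcs_winding_number[OF arcs(2,3) ends(3-6)] zn zk
    by simp
  then have "winding_number (g +++ reversepath h) z = 0"
    using arcs_winding_number[OF arcs(1,2) ends(1-4) zn] by simp
  moreover have "norm (winding_number (g +++ reversepath h) z) = 1"
    using simple_closed_path_norm_winding_number_inside[OF gh(1)] z gh(3) by simp
  ultimately show False by simp
qed

text \<open>The inside of a Jordan curve is connected; here it avoids
  \<open>path_image g \<union> K\<close>, so it lies in one component of that complement.\<close>

lemma theta_inside_subset:
  fixes g h :: "real \<Rightarrow> complex"
  assumes arcs: "arc g" "arc h"
    and ends: "pathstart g = a" "pathfinish g = b" "pathstart h = a" "pathfinish h = b"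
    and disj: "path_image g \<inter> path_image h \<subseteq> {a, b}"
    and K: "K \<inter> inside (path_image g \<union> path_image h) = {}"
    and meet: "inside (path_image g \<union> path_image h) \<inter> inside (path_image g \<union> K) \<noteq> {}"
  shows "inside (path_image g \<union> path_image h) \<subseteq> inside (path_image g \<union> K)"
proof
  fix y assume y: "y \<in> inside (path_image g \<union> path_image h)"
  obtain z where z: "z \<in> inside (path_image g \<union> path_image h)" "z \<in> inside (path_image g \<union> K)"
    using meet by blast
  note gh = two_arcs_simple_loop[OF arcs ends disj]
  have conn: "Topological_Spaces.connected (inside (path_image g \<union> path_image h))"
    using Jordan_inside_outside[OF gh(1,2)] gh(3) by simp
  have "inside (path_image g \<union> path_image h) \<subseteq> - (path_image g \<union> K)"
    using inside_no_overlap[of "path_image g \<union> path_image h"] K by blast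
  then have "connected_component (- (path_image g \<union> K)) z y"
    unfolding connected_component_def using conn y z(1) by blast
  then show "y \<in> inside (path_image g \<union> K)"
    using inside_same_component z(2) by blast
qed

text \<open>If the insides met, each would contain the other. Equal insides have equal frontiers,
  which would put \<open>k\<close> on \<open>g\<close> and \<open>h\<close>, although it meets them
  only in its ends.\<close>

lemma theta_insides_disjoint:
  fixes g h :: "real \<Rightarrow> complex"
  assumes arcs: "arc g" "arc h" "arc k"
    and ends: "pathstart g = a" "pathfinish g = b" "pathstart h = a" "pathfinish h = b"
      "pathstart k = a" "pathfinish k = b"
    and disj: "path_image g \<inter> path_image h \<subseteq> {a, b}" "path_image g \<inter> path_image k \<subseteq> {a, b}"
      "path_image h \<inter> path_image k \<subseteq> {a, b}"
    and out: "path_image k \<inter> inside (path_image g \<union> path_image h) = {}"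
      "path_image h \<inter> inside (path_image g \<union> path_image k) = {}"
  shows "inside (path_image g \<union> path_image h) \<inter> inside (path_image g \<union> path_image k) = {}"
proof (rule ccontr)
  assume meet: "\<not> ?thesis"
  note gh = two_arcs_simple_loop[OF arcs(1,2) ends(1-4) disj(1)]
  note gk = two_arcs_simple_loop[OF arcs(1,3) ends(1,2,5,6) disj(2)]
  have "inside (path_image g \<union> path_image h) = inside (path_image g \<union> path_image k)"
    using theta_inside_subset[OF arcs(1,2) ends(1-4) disj(1) out(1)]
      theta_inside_subset[OF arcs(1,3) ends(1,2,5,6) disj(2) out(2)] meet by blast
  moreover have "frontier (inside (path_image g \<union> path_image h)) = path_image g \<union> path_image h"
    using Jordan_inside_outside[OF gh(1,2)] gh(3) by simp
  moreover have "frontier (inside (path_image g \<union> path_image k)) = path_image g \<union> path_image k"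
    using Jordan_inside_outside[OF gk(1,2)] gk(3) by simp
  ultimately have "path_image k \<subseteq> path_image g \<union> path_image h" by (metis Un_upper2)
  then have "path_image k - {a, b} = {}" using disj(2,3) by fast
  moreover have "path_image k - {a, b} = k ` {0<..<1}"
    using simple_path_endless[OF arc_imp_simple_path[OF arcs(3)]] ends by simp
  ultimately show False by simp
qed

text \<open>Otherwise the inside of \<open>g\<close> and \<open>h\<close> is disjoint from the two
  insides formed with \<open>k\<close>, while \<open>theta_inside_winding\<close> places each of its
  points in one of these.\<close>

lemma theta_arc_inside:
  fixes g h :: "real \<Rightarrow> complex"
  assumes arcs: "arc g" "arc h" "arc k"
    and ends: "pathstart g = a" "pathfinish g = b" "pathstart h = a" "pathfinish h = b"
      "pathstart k = a" "pathfinish k = b"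
    and disj: "path_image g \<inter> path_image h \<subseteq> {a, b}" "path_image g \<inter> path_image k \<subseteq> {a, b}"
      "path_image h \<inter> path_image k \<subseteq> {a, b}"
  shows "path_image k \<inter> inside (path_image g \<union> path_image h) \<noteq> {}
    \<or> path_image h \<inter> inside (path_image g \<union> path_image k) \<noteq> {}
    \<or> path_image g \<inter> inside (path_image h \<union> path_image k) \<noteq> {}"
proof (rule ccontr)
  assume "\<not> ?thesis"
  then have out: "path_image k \<inter> inside (path_image g \<union> path_image h) = {}"
      "path_image h \<inter> inside (path_image g \<union> path_image k) = {}"
      "path_image g \<inter> inside (path_image h \<union> path_image k) = {}"
    by blast+
  note gh = two_arcs_simple_loop[OF arcs(1,2) ends(1-4) disj(1)]
  have "inside (path_image g \<union> path_image h) \<noteq> {}"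
    using Jordan_inside_outside[OF gh(1,2)] gh(3) by simp
  then obtain z where z: "z \<in> inside (path_image g \<union> path_image h)" by blast
  have "inside (path_image g \<union> path_image h) \<inter> inside (path_image g \<union> path_image k) = {}"
    using theta_insides_disjoint[OF arcs ends disj out(1,2)] .
  moreover have "inside (path_image h \<union> path_image g) \<inter> inside (path_image h \<union> path_image k) = {}"
    using theta_insides_disjoint[OF arcs(2,1,3) ends(3,4,1,2,5,6)] disj out by (simp add: Un_commute Int_commute)
  ultimately show False
    using theta_inside_winding[OF arcs ends disj out(1) z] z by (simp add: Un_commute disjoint_iff)
qed

text \<open>Without its ends, \<open>k\<close> is connected and avoids the Jordan curve, so it stays
  on one side. The open inside is disjoint from \<open>outside D\<close> and hence from its closure,
  so the point \<open>q\<close> excludes that side.\<close>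

lemma arc_misses_inside:
  fixes g h :: "real \<Rightarrow> complex"
  assumes arcs: "arc g" "arc h" "arc k"
    and ends: "pathstart g = a" "pathfinish g = b" "pathstart h = a" "pathfinish h = b"
      "pathstart k = a" "pathfinish k = b"
    and disj: "path_image g \<inter> path_image h \<subseteq> {a, b}" "path_image g \<inter> path_image k \<subseteq> {a, b}"
      "path_image h \<inter> path_image k \<subseteq> {a, b}"
    and D: "path_image g \<union> path_image h \<subseteq> D"
    and q: "q \<in> path_image k" "q \<noteq> a" "q \<noteq> b" "q \<in> frontier (outside D)"
  shows "path_image k \<inter> inside (path_image g \<union> path_image h) = {}"
proof (rule ccontr)
  assume meet: "\<not> ?thesis"
  let ?J = "path_image g \<union> path_image h"
  let ?K = "path_image k - {a, b}"
  note gh = two_arcs_simple_loop[OF arcs(1,2) ends(1-4) disj(1)]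
  have J: "open (inside ?J)" "open (outside ?J)"
    using Jordan_inside_outside[OF gh(1,2)] gh(3) by simp_all
  have conn: "Topological_Spaces.connected ?K"
    using connected_simple_path_endless[OF arc_imp_simple_path[OF arcs(3)]] ends by simp
  have ab: "a \<in> ?J" "b \<in> ?J"
    using pathstart_in_path_image[of g] pathfinish_in_path_image[of g] ends by auto
  have "?K \<inter> ?J = {}" using disj(2,3) by fast
  then have "?K \<subseteq> inside ?J \<union> outside ?J" using inside_Un_outside[of ?J] by blast
  moreover have "inside ?J \<inter> ?K \<noteq> {}"
    using meet ab inside_no_overlap[of ?J] by blast
  moreover have "inside ?J \<inter> outside ?J \<inter> ?K = {}" using inside_Int_outside by blast
  ultimately have "outside ?J \<inter> ?K = {}"
    using connectedD[OF conn J(1,2)] by blast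
  then have "q \<in> inside ?J" using \<open>?K \<subseteq> _\<close> q by blast
  moreover have "outside D \<subseteq> outside ?J" using D by (rule outside_mono)
  then have "inside ?J \<inter> outside D = {}" using inside_Int_outside by blast
  then have "inside ?J \<inter> closure (outside D) = {}" using J(1) open_Int_closure_eq_empty by blast
  ultimately show False using q(4) by (auto simp: frontier_def)
qed

text \<open>A point of the outer frontier on each arc keeps every arc out of the inside of the other
  two, against \<open>theta_arc_inside\<close>.\<close>

lemma theta_outer_points:
  fixes g h :: "real \<Rightarrow> complex"
  assumes arcs: "arc g" "arc h" "arc k"
    and ends: "pathstart g = a" "pathfinish g = b" "pathstart h = a" "pathfinish h = b"
      "pathstart k = a" "pathfinish k = b"
    and disj: "path_image g \<inter> path_image h \<subseteq> {a, b}" "path_image g \<inter> path_image k \<subseteq> {a, b}"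
      "path_image h \<inter> path_image k \<subseteq> {a, b}"
    and D: "path_image g \<union> path_image h \<union> path_image k \<subseteq> D"
    and q: "u \<in> path_image g - {a, b}" "v \<in> path_image h - {a, b}" "w \<in> path_image k - {a, b}"
      "{u, v, w} \<subseteq> frontier (outside D)"
  shows False
proof -
  have disj': "path_image h \<inter> path_image g \<subseteq> {a, b}" "path_image k \<inter> path_image g \<subseteq> {a, b}"
      "path_image k \<inter> path_image h \<subseteq> {a, b}" using disj by blast+
  have "path_image k \<inter> inside (path_image g \<union> path_image h) = {}"
    by (rule arc_misses_inside[OF arcs ends disj, of D w]) (use D q in auto)
  moreover have "path_image h \<inter> inside (path_image g \<union> path_image k) = {}"
    by (rule arc_misses_inside[OF arcs(1,3,2) ends(1,2,5,6,3,4) disj(2,1) disj'(3), of D v]) (use D q in auto)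
  moreover have "path_image g \<inter> inside (path_image h \<union> path_image k) = {}"
    by (rule arc_misses_inside[OF arcs(2,3,1) ends(3-6,1,2) disj(3) disj'(1,2), of D u]) (use D q in auto)
  ultimately show False using theta_arc_inside[OF arcs ends disj] by blast
qed

section \<open>Outerplanar drawings\<close>

locale outerplane_drawing = graph G for G :: "('a, 'b) pre_digraph" +
  fixes p :: "'a \<Rightarrow> complex" and \<gamma> :: "'a set \<Rightarrow> real \<Rightarrow> complex"
  assumes planar: "planar_drawing G p \<gamma>"
    and outer: "\<And>v. v \<in> verts G \<Longrightarrow> p v \<in> frontier (outer_face G p \<gamma>)"
begin

lemma dominates_sym: "u \<rightarrow>\<^bsub>G\<^esub> v \<Longrightarrow> v \<rightarrow>\<^bsub>G\<^esub> u"
  using sym_arcs by (auto simp: symmetric_def dest: symD)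

sublocale sym_rel "\<lambda>u v. u \<rightarrow>\<^bsub>G\<^esub> v"
  by unfold_locales (rule dominates_sym)

lemma inj_p: "u \<in> verts G \<Longrightarrow> v \<in> verts G \<Longrightarrow> p u = p v \<Longrightarrow> u = v"
  using planar by (auto simp: planar_drawing_def dest: inj_onD)

lemma edge_arc: "e \<in> edges G \<Longrightarrow> Path_Connected.arc (\<gamma> e)"
  and edge_vertices: "e \<in> edges G \<Longrightarrow> path_image (\<gamma> e) \<inter> p ` verts G = p ` e"
  and edge_inter: "e \<in> edges G \<Longrightarrow> f \<in> edges G \<Longrightarrow> e \<noteq> f
    \<Longrightarrow> path_image (\<gamma> e) \<inter> path_image (\<gamma> f) \<subseteq> p ` (e \<inter> f)"
  using planar unfolding planar_drawing_def by blast+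

lemma edge_in_verts: "e \<in> edges G \<Longrightarrow> e \<subseteq> verts G"
  by (auto simp: edges_def dest: adj_in_verts)

lemma edge_ends: "e \<in> edges G \<Longrightarrow> p ` e \<subseteq> path_image (\<gamma> e)"
  using edge_vertices by blast

section \<open>Arcs through drawings of connected subgraphs\<close>

definition draw :: "'a set \<Rightarrow> complex set" where
  "draw S = p ` S \<union> (\<Union>e\<in>{e \<in> edges G. e \<subseteq> S}. path_image (\<gamma> e))"

text \<open>Let \<open>T\<close> be the vertices reachable from \<open>p s\<close> within the
  drawing. An edge of \<open>S\<close> leaving \<open>T\<close> would be drawn in
  \<open>draw S\<close> and extend it, so \<open>T = S\<close>.\<close>

lemma path_connected_draw:
  assumes "conn S"
  shows "path_connected (draw S)"
proof -
  obtain s where s: "s \<in> S" using conn_ne[OF assms] by blast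
  have edge: "path_component (draw S) x y"
    if "e \<in> edges G" "e \<subseteq> S" "x \<in> path_image (\<gamma> e)" "y \<in> path_image (\<gamma> e)" for e x y
  proof -
    have "path_connected (path_image (\<gamma> e))"
      using edge_arc[OF that(1)] by (simp add: arc_imp_path path_connected_path_image)
    then have "path_component (path_image (\<gamma> e)) x y"
      using that(3,4) by (simp add: path_connected_component)
    moreover have "path_image (\<gamma> e) \<subseteq> draw S" using that by (auto simp: draw_def)
    ultimately show ?thesis by (rule path_component_of_subset[rotated])
  qed
  define T where "T = {t \<in> S. path_component (draw S) (p s) (p t)}"
  have "p s \<in> draw S" using s by (simp add: draw_def)
  then have "s \<in> T" using s by (simp add: T_def path_component_refl)
  have "T = S"
  proof (rule ccontr)
    assume "T \<noteq> S"
    then obtain u v where uv: "u \<in> T" "v \<in> S - T" "u \<rightarrow>\<^bsub>G\<^esub> v"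
      using conn_edge[OF assms, of T] \<open>s \<in> T\<close> by (auto simp: T_def)
    then have e: "{u, v} \<in> edges G" "{u, v} \<subseteq> S" by (auto simp: edges_def T_def)
    then have "path_component (draw S) (p u) (p v)"
      using edge[OF e] edge_ends[OF e(1)] by simp
    then have "v \<in> T" using uv by (auto simp: T_def intro: path_component_trans)
    then show False using uv by simp
  qed
  have "path_component (draw S) (p s) x" if x: "x \<in> draw S" for x
  proof -
    consider t where "t \<in> S" "x = p t" | e where "e \<in> edges G" "e \<subseteq> S" "x \<in> path_image (\<gamma> e)"
      using x by (auto simp: draw_def)
    then show ?thesis
    proof cases
      case 1
      then show ?thesis using \<open>T = S\<close> by (auto simp: T_def)
    next
      case 2
      obtain t where t: "t \<in> e" using 2(1) by (auto simp: edges_def)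
      then have "path_component (draw S) (p t) x"
        using edge[OF 2(1,2) _ 2(3)] edge_ends[OF 2(1)] by blast
      moreover have "path_component (draw S) (p s) (p t)" using t 2(2) \<open>T = S\<close> by (auto simp: T_def)
      ultimately show ?thesis by (blast intro: path_component_trans)
    qed
  qed
  then show ?thesis
    unfolding path_connected_component by (blast intro: path_component_trans path_component_sym)
qed

text \<open>The drawing of \<open>S\<close> with its edges to \<open>a\<close> and \<open>b\<close>.
  Each edge must meet \<open>S\<close>, which excludes the edge \<open>{a, b}\<close>; thus the
  spans of disjoint sets avoiding \<open>a\<close> and \<open>b\<close> share no edge.\<close>

definition edge_span :: "'a set \<Rightarrow> 'a \<Rightarrow> 'a \<Rightarrow> complex set" where
  "edge_span S a b = p ` S \<union> (\<Union>e\<in>{e \<in> edges G. e \<subseteq> S \<union> {a, b} \<and> e \<inter> S \<noteq> {}}. path_image (\<gamma> e))"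

lemma edge_span_inter:
  assumes "S \<subseteq> verts G" "T \<subseteq> verts G" "S \<inter> T = {}" "a \<notin> S \<union> T" "b \<notin> S \<union> T"
  shows "edge_span S a b \<inter> edge_span T a b \<subseteq> {p a, p b}"
proof
  fix x assume x: "x \<in> edge_span S a b \<inter> edge_span T a b"
  have vertex: False if "s \<in> S'" "S' \<subseteq> verts G" "s \<notin> T'" "a \<notin> S'" "b \<notin> S'" "p s \<in> path_image (\<gamma> e)"
    "e \<in> edges G" "e \<subseteq> T' \<union> {a, b}" for s e S' T'
  proof -
    have "p s \<in> p ` e" using that edge_vertices[OF that(7)] by blast
    then have "s \<in> e" using that edge_in_verts[OF that(7)] inj_p by blast
    then show False using that by blast
  qed
  consider s t where "s \<in> S" "t \<in> T" "x = p s" "x = p t"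
    | s e where "s \<in> S" "x = p s" "e \<in> edges G" "e \<subseteq> T \<union> {a, b}" "x \<in> path_image (\<gamma> e)"
    | s e where "s \<in> T" "x = p s" "e \<in> edges G" "e \<subseteq> S \<union> {a, b}" "x \<in> path_image (\<gamma> e)"
    | e f where "e \<in> edges G" "e \<subseteq> S \<union> {a, b}" "e \<inter> S \<noteq> {}" "x \<in> path_image (\<gamma> e)"
        "f \<in> edges G" "f \<subseteq> T \<union> {a, b}" "x \<in> path_image (\<gamma> f)"
    using x unfolding edge_span_def by blast
  then show "x \<in> {p a, p b}"
  proof cases
    case 1
    then have "s = t" using inj_p assms(1,2) by (metis subsetD)
    then show ?thesis using 1 assms(3) by blast
  next
    case 2
    then show ?thesis using vertex[of s S T e] assms by blast
  next
    case 3
    then show ?thesis using vertex[of s T S e] assms by blast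
  next
    case 4
    have "e \<noteq> f" using 4(3,6) assms(3-5) by blast
    then have "x \<in> p ` (e \<inter> f)" using edge_inter[OF 4(1,5)] 4(4,7) by blast
    moreover have "e \<inter> f \<subseteq> {a, b}" using 4(2,6) assms(3) by blast
    ultimately show ?thesis by blast
  qed
qed

lemma edge_span_subset: "S \<subseteq> verts G \<Longrightarrow> edge_span S a b \<subseteq> drawing_points G p \<gamma>"
  by (auto simp: edge_span_def drawing_points_def)

text \<open>The edges \<open>{a, s}\<close> and \<open>{b, t}\<close> together with
  \<open>draw S\<close> form a path-connected set, which contains an arc. The vertex
  \<open>v\<close> on it is recorded because its point will lie on the outer face.\<close>

lemma arc_through:
  assumes S: "conn S" "S \<subseteq> verts G" and ab: "a \<noteq> b" "a \<notin> S" "b \<notin> S"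
    and touch: "touch {a} S" "touch {b} S"
  obtains g v where "Path_Connected.arc g" "pathstart g = p a" "pathfinish g = p b" "path_image g \<subseteq> edge_span S a b"
    "v \<in> S" "p v \<in> path_image g"
proof -
  obtain s t where st: "s \<in> S" "a \<rightarrow>\<^bsub>G\<^esub> s" "t \<in> S" "b \<rightarrow>\<^bsub>G\<^esub> t" using touch by (auto simp: touch_def)
  then have ab_V: "a \<in> verts G" "b \<in> verts G" by (auto dest: adj_in_verts)
  let ?E = "path_image (\<gamma> {a, s})" and ?F = "path_image (\<gamma> {b, t})"
  have e: "{a, s} \<in> edges G" "{b, t} \<in> edges G" using st by (auto simp: edges_def)
  have in_draw: "p s \<in> draw S" "p t \<in> draw S" using st by (auto simp: draw_def)
  have ends: "p a \<in> ?E" "p s \<in> ?E" "p b \<in> ?F" "p t \<in> ?F" using edge_ends[OF e(1)] edge_ends[OF e(2)] by auto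
  have pc: "path_connected ?E" "path_connected ?F"
    using edge_arc e by (simp_all add: arc_imp_path path_connected_path_image)
  have "path_connected (draw S \<union> ?F)"
    using path_connected_Un[OF path_connected_draw[OF S(1)] pc(2)] in_draw ends by blast
  then have "path_connected (?E \<union> (draw S \<union> ?F))"
    using path_connected_Un[OF pc(1)] in_draw ends by blast
  moreover have "p a \<noteq> p b" using inj_p ab_V ab by blast
  ultimately obtain g where g: "Path_Connected.arc g" "path_image g \<subseteq> ?E \<union> (draw S \<union> ?F)"
    "pathstart g = p a" "pathfinish g = p b"
    using ends unfolding path_connected_arcwise by (metis UnI1 UnI2)
  have closed_edge: "closed (path_image (\<gamma> e))" if "e \<in> edges G" for e
    using edge_arc[OF that] by (simp add: closed_arc_image)
  have "finite (verts G)" by (rule finite_verts)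
  then have "finite (Pow (verts G))" by simp
  then have fin: "finite (edges G)" by (rule finite_subset[rotated]) (auto dest: edge_in_verts)
  have "finite S" using S(2) finite_verts finite_subset by blast
  then have "closed (draw S)"
    unfolding draw_def using closed_edge fin
    by (intro closed_Un closed_UN finite_imp_closed) auto
  then have cl: "closed ?E" "closed (draw S \<union> ?F)"
    using closed_edge e by (simp_all add: closed_Un)
  \<comment> \<open>The connected image of \<open>g\<close> is covered by two closed sets and meets
    both, so it contains a common point of them.\<close>
  have "\<exists>x. x \<in> path_image g \<and> x \<in> ?E \<and> x \<in> draw S \<union> ?F"
  proof -
    have "Topological_Spaces.connected (path_image g)" using g(1) by (simp add: arc_imp_path connected_path_image)
    moreover have "?E \<inter> path_image g \<noteq> {}" "(draw S \<union> ?F) \<inter> path_image g \<noteq> {}"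
      using ends g pathstart_in_path_image[of g] pathfinish_in_path_image[of g] by auto
    ultimately show ?thesis using connected_closedD[of "path_image g" ?E "draw S \<union> ?F"] cl g(2) by blast
  qed
  then obtain x where x: "x \<in> path_image g" "x \<in> ?E" "x \<in> draw S \<union> ?F" by blast
  have "x \<in> p ` S"
  proof -
    consider "x \<in> p ` S" | f where "f \<in> edges G" "f \<subseteq> insert b S" "x \<in> path_image (\<gamma> f)"
      using x(3) e st by (auto simp: draw_def)
    then show ?thesis
    proof cases
      case 2
      \<comment> \<open>As \<open>f\<close> avoids \<open>a\<close>, the two edges differ and can
        share only the point of \<open>s\<close>.\<close>
      then have "f \<noteq> {a, s}" using ab by blast
      then have "x \<in> p ` ({a, s} \<inter> f)" using edge_inter[OF e(1) 2(1)] x(2) 2(3) by blast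
      moreover have "{a, s} \<inter> f \<subseteq> S" using 2(2) ab st by blast
      ultimately show ?thesis by blast
    qed
  qed
  then obtain v where v: "v \<in> S" "p v \<in> path_image g" using x(1) by blast
  have "draw S \<subseteq> edge_span S a b"
  proof -
    have "{e \<in> edges G. e \<subseteq> S} \<subseteq> {e \<in> edges G. e \<subseteq> S \<union> {a, b} \<and> e \<inter> S \<noteq> {}}"
      by (auto simp: edges_def)
    then show ?thesis unfolding draw_def edge_span_def by (intro Un_mono UN_mono) auto
  qed
  moreover have "?E \<subseteq> edge_span S a b" "?F \<subseteq> edge_span S a b" using e st by (auto simp: edge_span_def)
  ultimately have "path_image g \<subseteq> edge_span S a b" using g(2) by blast
  then show thesis using that[OF g(1,3,4)] v by blast
qed

text \<open>Arcs through \<open>S\<close>, \<open>T\<close> and \<open>U\<close> form a theta curve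
  with ends \<open>p a\<close> and \<open>p b\<close>, and each carries the point of an inner vertex
  on the outer face.\<close>

lemma no_K23_minor_singletons:
  assumes K: "K23_minor {a} {b} S T U" and V: "S \<union> T \<union> U \<subseteq> verts G" "a \<in> verts G" "b \<in> verts G"
  shows False
proof -
  have ab: "a \<noteq> b" "a \<notin> S \<union> T \<union> U" "b \<notin> S \<union> T \<union> U"
    and disj: "S \<inter> T = {}" "S \<inter> U = {}" "T \<inter> U = {}"
    and c: "conn S" "conn T" "conn U" "touch {a} S" "touch {a} T" "touch {a} U"
      "touch {b} S" "touch {b} T" "touch {b} U"
    using K by (auto simp: K23_minor_def)
  obtain g u where g: "Path_Connected.arc g" "pathstart g = p a" "pathfinish g = p b" "path_image g \<subseteq> edge_span S a b"
    "u \<in> S" "p u \<in> path_image g"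
    using arc_through[of S a b] c ab V by auto
  obtain h v where h: "Path_Connected.arc h" "pathstart h = p a" "pathfinish h = p b" "path_image h \<subseteq> edge_span T a b"
    "v \<in> T" "p v \<in> path_image h"
    using arc_through[of T a b] c ab V by auto
  obtain k w where k: "Path_Connected.arc k" "pathstart k = p a" "pathfinish k = p b" "path_image k \<subseteq> edge_span U a b"
    "w \<in> U" "p w \<in> path_image k"
    using arc_through[of U a b] c ab V by auto
  have "p x \<noteq> p a \<and> p x \<noteq> p b \<and> p x \<in> frontier (outer_face G p \<gamma>)" if "x \<in> S \<union> T \<union> U" for x
    using that inj_p[of x a] inj_p[of x b] V ab outer by blast
  then have q: "p u \<in> path_image g - {p a, p b}" "p v \<in> path_image h - {p a, p b}"
      "p w \<in> path_image k - {p a, p b}" "{p u, p v, p w} \<subseteq> frontier (outside (drawing_points G p \<gamma>))"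
    using g(5,6) h(5,6) k(5,6) by (auto simp: outer_face_def)
  have "edge_span S a b \<inter> edge_span T a b \<subseteq> {p a, p b}" "edge_span S a b \<inter> edge_span U a b \<subseteq> {p a, p b}"
    "edge_span T a b \<inter> edge_span U a b \<subseteq> {p a, p b}"
    using edge_span_inter V disj ab by auto
  then have "path_image g \<inter> path_image h \<subseteq> {p a, p b}" "path_image g \<inter> path_image k \<subseteq> {p a, p b}"
    "path_image h \<inter> path_image k \<subseteq> {p a, p b}"
    using g(4) h(4) k(4) by blast+
  moreover have "path_image g \<union> path_image h \<union> path_image k \<subseteq> drawing_points G p \<gamma>"
    using g(4) h(4) k(4) edge_span_subset[of _ a b] V by blast
  ultimately show False
    using theta_outer_points[OF g(1) h(1) k(1) g(2,3) h(2,3) k(2,3)] q by blast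
qed

lemma no_K23_minor_in_verts:
  assumes "A \<union> B \<union> S \<union> T \<union> U \<subseteq> verts G"
  shows "\<not> K23_minor A B S T U"
proof
  assume K: "K23_minor A B S T U"
  have "finite A" "finite B" using assms finite_verts by (auto intro: finite_subset)
  then obtain a b S' T' U' where "a \<in> A" "b \<in> B" "K23_minor {a} {b} S' T' U'"
    "S' \<union> T' \<union> U' \<subseteq> A \<union> B \<union> S \<union> T \<union> U"
    using K23_minor_singletons[OF K] by blast
  then show False using no_K23_minor_singletons assms by blast
qed

text \<open>A walk from \<open>T\<close> to a vertex outside it must cross the cut at some
  step.\<close>

lemma conn_verts:
  assumes "Digraph_Component.connected G"
  shows "conn (verts G)"
  unfolding conn_def
proof (intro conjI allI impI)
  have ne: "verts G \<noteq> {}" and reach: "\<And>u v. u \<in> verts G \<Longrightarrow> v \<in> verts G \<Longrightarrow> u \<rightarrow>\<^sup>*\<^bsub>G\<^esub> v"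
    using assms reachable_mk_symmetric_eq[OF sym_arcs]
    by (auto simp: connected_def strongly_connected_def)
  show "verts G \<noteq> {}" by (rule ne)
  fix T assume T: "T \<subseteq> verts G" "T \<noteq> {}" "T \<noteq> verts G"
  then obtain u v where uv: "u \<in> T" "v \<in> verts G - T" by blast
  have "u \<rightarrow>\<^sup>*\<^bsub>G\<^esub> v" using reach uv T by blast
  then show "\<exists>u\<in>T. \<exists>v\<in>verts G - T. u \<rightarrow>\<^bsub>G\<^esub> v" using uv(2,1)
  proof (induction rule: reachable_induct)
    case base
    then show ?case by blast
  next
    case (step x y)
    show ?case
    proof (cases "x \<in> T")
      case True
      then show ?thesis using step by blast
    next
      case False
      then show ?thesis using step by (auto dest: adj_in_verts)
    qed
  qed
qed

end

theorem theorem2: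
  fixes G :: "('a, 'b) pre_digraph"
  assumes "graph G"
    and "Digraph_Component.connected G"
    and "outerplanar G"
    and "card (verts G) \<ge> 2"
  shows "(\<exists>C. complete_cf_coloring G 4 C) \<and> chi_CF G \<le> 4"
proof -
  obtain p \<gamma> where d: "planar_drawing G p \<gamma>" "\<forall>v\<in>verts G. p v \<in> frontier (outer_face G p \<gamma>)"
    using assms(3) by (auto simp: outerplanar_def)
  interpret graph G by (rule assms(1))
  interpret outerplane_drawing G p \<gamma> using d by unfold_locales auto
  interpret K23_free_graph "\<lambda>u v. u \<rightarrow>\<^bsub>G\<^esub> v" "verts G"
    using assms(4) conn_verts[OF assms(2)] no_K23_minor_in_verts
    by unfold_locales (auto dest: adj_in_verts adj_not_same)
  obtain C where C: "\<And>v. v \<in> verts G \<Longrightarrow> C v \<in> {1..4 :: nat}"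
    "\<And>v. v \<in> verts G \<Longrightarrow> \<exists>u. v \<rightarrow>\<^bsub>G\<^esub> u \<and> (\<forall>u'. v \<rightarrow>\<^bsub>G\<^esub> u' \<longrightarrow> C u' = C u \<longrightarrow> u' = u)"
    using complete_cf_4_colouring by auto
  have "\<exists>i\<in>{1..4}. card (nbhd G v \<inter> C -` {i}) = 1" if v: "v \<in> verts G" for v
  proof -
    obtain u where u: "v \<rightarrow>\<^bsub>G\<^esub> u" "\<forall>u'. v \<rightarrow>\<^bsub>G\<^esub> u' \<longrightarrow> C u' = C u \<longrightarrow> u' = u"
      using C(2)[OF v] by blast
    then have "nbhd G v \<inter> C -` {C u} = {u}" by (auto simp: nbhd_def)
    moreover have "C u \<in> {1..4}" using C(1) u(1) by (auto dest: adj_in_verts)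
    ultimately show ?thesis by (intro bexI[of _ "C u"]) simp_all
  qed
  then have "complete_cf_coloring G 4 C" using C(1) by (auto simp: complete_cf_coloring_def)
  then show ?thesis unfolding chi_CF_def by (blast intro: Least_le)
qed

end
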